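(* Let $K$ be an arbitrary uncountable, compact subspace of $\mathbb{R}^n$. Then there exists a subspace $X$ of $\mathbb{C}^{n+4}$ homeomorphic to $K$ such that $\widehat{X}\setminus X\neq\emptyset$ but $\widehat{X}$ contains no analytic discs.
   Context: For a compact set $X\subset\mathbb{C}^N$, the polynomial hull is $\widehat{X}=\{z\in\mathbb{C}^N: |p(z)|\le \max_{x\in X}|p(x)| \text{ for all polynomials } p\}$. An analytic disc in $\mathbb{C}^N$ is an injective holomorphic map $\sigma:D\to\mathbb{C}^N$, where $D$ is the open unit disc in $\mathbb{C}$; a set $S\subset\mathbb{C}^N$ contains no analytic discs if there is no analytic disc whose image is contained in $S$. *)

theory Defs
  imports "HOL-Analysis.Analysis"
begin

definition poly_fun :: "((complex ^ 'n) \<Rightarrow> complex) \<Rightarrow> bool" where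
  "poly_fun p \<longleftrightarrow> (\<exists>A c. finite (A :: ('n \<Rightarrow> nat) set) \<and>
      p = (\<lambda>z. \<Sum>\<alpha>\<in>A. c \<alpha> * (\<Prod>i\<in>UNIV. (z $ i) ^ (\<alpha> i))))"

definition poly_hull :: "(complex ^ 'n) set \<Rightarrow> (complex ^ 'n) set" where
  "poly_hull X = {z. \<forall>p. poly_fun p \<longrightarrow> norm (p z) \<le> (SUP x\<in>X. norm (p x))}"

definition analytic_disc :: "(complex \<Rightarrow> complex ^ 'n) \<Rightarrow> bool" where
  "analytic_disc \<sigma> \<longleftrightarrow> inj_on \<sigma> (ball 0 1) \<and>
      (\<forall>i. (\<lambda>w. \<sigma> w $ i) holomorphic_on ball 0 1)"

definition contains_no_analytic_disc :: "(complex ^ 'n) set \<Rightarrow> bool" where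
  "contains_no_analytic_disc S \<longleftrightarrow> \<not> (\<exists>\<sigma>. analytic_disc \<sigma> \<and> \<sigma> ` ball 0 1 \<subseteq> S)"

end

theory Submission
  imports Defs "HOL-Complex_Analysis.Residue_Theorem"
begin

text \<open>
  Remove from the closed unit ball of \<open>\<complex>\<^sup>3\<close> thin shells around countably many spheres, dense enough that
  the remaining compact set \<open>X\<^sub>0\<close> is totally disconnected. Analytic sets of positive dimension cannot
  live in thin shells, so every analytic curve through \<open>0\<close> still meets \<open>X\<^sub>0\<close>.
  Put \<open>P\<^sub>0 = 1 + t\<close> and \<open>P\<^sub>k\<^sub>+\<^sub>1 = p\<^sub>k exp (m\<^sub>k (P\<^sub>k - 1))\<close>, where \<open>p\<^sub>k\<close> runs through the functions
  \<open>1 - x / a\<close> and \<open>1 - y / a\<close> for a countable dense set of \<open>a\<close>. For large \<open>m\<^sub>k\<close> the sets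
  \<open>Re P\<^sub>k \<ge> 1/2\<close> decrease on the unit ball; let \<open>E\<close> be the intersection of all of them with \<open>X\<^sub>0\<close>.
  For every polynomial \<open>q\<close> the curve \<open>P\<^sub>k = 1, q = q(0)\<close> meets \<open>X\<^sub>0\<close>, and in the limit \<open>q\<close> takes the value
  \<open>q(0)\<close> on \<open>E\<close>; hence \<open>0\<close> lies in the hull of \<open>E\<close>. On that hull \<open>Re P\<^sub>k \<ge> 1/2\<close>, so \<open>x\<close> and \<open>y\<close> omit a dense
  set and are constant on analytic discs, and then so is \<open>t\<close> because the logarithmic derivatives of the
  \<open>P\<^sub>k\<close> in \<open>t\<close> blow up while their values stay in a half plane.

  Finally \<open>K\<close> contains a copy \<open>C\<close> of \<open>E\<close>. Extend the homeomorphism \<open>C \<rightarrow> E\<close> to \<open>H : K \<rightarrow> \<complex>\<^sup>3\<close> and map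
  \<open>x \<in> K\<close> to \<open>(d(x,C), d(x,C) x, H x)\<close>. The first \<open>n + 1\<close> coordinates are real, so the hull of the image is
  the union of the hulls of its fibres over them, which are single points and \<open>E\<close>.
\<close>

section \<open>Separately holomorphic functions of two variables\<close>

text \<open>Cauchy's formula writes the derivative as an integral over a circle that stays fixed
  near a given point, with an integrand jointly continuous in \<open>x\<close>, \<open>y\<close> and
  the circle parameter.\<close>

lemma continuous_on_deriv_param:
  fixes f :: "complex \<Rightarrow> 'a::metric_space \<Rightarrow> complex"
  assumes S: "open S"
    and cont: "continuous_on (S \<times> T) (\<lambda>(x, y). f x y)"
    and hol: "\<And>y. y \<in> T \<Longrightarrow> (\<lambda>x. f x y) holomorphic_on S"
  shows "continuous_on (S \<times> T) (\<lambda>(x, y). deriv (\<lambda>x. f x y) x)"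
proof -
  have loc: "\<exists>U. open U \<and> p \<in> U \<and> continuous_on (S \<times> T \<inter> U) (\<lambda>(x, y). deriv (\<lambda>x. f x y) x)"
    if pST: "p \<in> S \<times> T" for p
  proof -
    obtain x0 y0 where p: "p = (x0, y0)" "x0 \<in> S" "y0 \<in> T" using pST by auto
    obtain e where e: "e > 0" "cball x0 e \<subseteq> S" using p S open_contains_cball by blast
    let ?U = "ball x0 e \<times> (UNIV :: 'a set)"
    let ?g = "\<lambda>p u. f (circlepath x0 e u) (snd p) / (circlepath x0 e u - fst p)\<^sup>2
                 * vector_derivative (circlepath x0 e) (at u)"
    have circ: "circlepath x0 e u \<in> cball x0 e" "dist x0 (circlepath x0 e u) = e" for u
      using e by (auto simp: circlepath dist_norm norm_mult)
    have eq: "deriv (\<lambda>x. f x y) x = 1 / (2 * of_real pi * \<i>) * integral {0..1} (?g (x, y))"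
      if "x \<in> ball x0 e" "y \<in> T" for x y
    proof -
      have "(\<lambda>x. f x y) holomorphic_on cball x0 e"
        using hol[OF that(2)] e(2) holomorphic_on_subset by blast
      then have "continuous_on (cball x0 e) (\<lambda>x. f x y)" "(\<lambda>x. f x y) holomorphic_on ball x0 e"
        using holomorphic_on_imp_continuous_on holomorphic_on_subset ball_subset_cball by blast+
      from Cauchy_derivative_integral_circlepath(2)[OF this that(1)]
      show ?thesis
        by (simp add: DERIV_imp_deriv contour_integral_integral)
    qed
    have "continuous_on ((ball x0 e \<times> T) \<times> cbox 0 1) (\<lambda>(p, u). ?g p u)"
    proof -
      have c: "continuous_on UNIV (circlepath x0 e)"
        unfolding circlepath by (intro continuous_intros)
      have 1: "continuous_on ((ball x0 e \<times> T) \<times> cbox 0 1) (\<lambda>w. circlepath x0 e (snd w))"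
        by (rule continuous_on_compose2[OF c]) (auto intro: continuous_intros)
      have 2: "continuous_on ((ball x0 e \<times> T) \<times> cbox 0 1)
           (\<lambda>w. (\<lambda>(x,y). f x y) (circlepath x0 e (snd w), snd (fst w)))"
        by (rule continuous_on_compose2[OF cont])
           (use circ(1) e(2) in \<open>auto intro!: continuous_intros 1[simplified]\<close>)
      have 3: "circlepath x0 e (snd w) - fst (fst w) \<noteq> 0" if "w \<in> (ball x0 e \<times> T) \<times> cbox 0 1" for w
        using that circ(2)[of "snd w"] by auto
      show ?thesis
        using 2 3 unfolding vector_derivative_circlepath split_beta
        by (intro continuous_intros 1) auto
    qed
    then have "continuous_on (ball x0 e \<times> T) (\<lambda>p. integral (cbox 0 1) (?g p))"
      by (rule integral_continuous_on_param)
    then have "continuous_on (ball x0 e \<times> T) (\<lambda>p. 1 / (2 * of_real pi * \<i>) * integral {0..1} (?g p))"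
      by (intro continuous_intros) (auto simp: cbox_interval)
    then have "continuous_on (ball x0 e \<times> T) (\<lambda>(x, y). deriv (\<lambda>x. f x y) x)"
      by (rule continuous_on_cong[THEN iffD1, rotated -1]) (auto simp: eq)
    moreover have "S \<times> T \<inter> ?U = ball x0 e \<times> T" using e(2) ball_subset_cball by blast
    ultimately show ?thesis
      using e(1) p by (intro exI[of _ ?U]) (auto intro: open_Times)
  qed
  have "continuous (at p within S \<times> T) (\<lambda>(x, y). deriv (\<lambda>x. f x y) x)" if p: "p \<in> S \<times> T" for p
  proof -
    obtain U where U: "open U" "p \<in> U"
        "continuous_on (S \<times> T \<inter> U) (\<lambda>(x, y). deriv (\<lambda>x. f x y) x)"
      using loc[OF p] by (elim exE conjE)
    have "continuous (at p within S \<times> T \<inter> U) (\<lambda>(x, y). deriv (\<lambda>x. f x y) x)"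
      using U(3) unfolding continuous_on_eq_continuous_within
      by (rule bspec) (rule IntI[OF p U(2)])
    moreover have "at p within S \<times> T = at p within S \<times> T \<inter> U"
      by (rule at_within_nhd[OF U(2,1)]) auto
    ultimately show ?thesis by simp
  qed
  then show ?thesis
    unfolding continuous_on_eq_continuous_within by (rule ballI)
qed

text \<open>Differentiation under the integral sign; \<open>continuous_on_deriv_param\<close>
  supplies the joint continuity of the differentiated integrand.\<close>

lemma holomorphic_contour_integral_circlepath:
  fixes f :: "complex \<Rightarrow> complex \<Rightarrow> complex"
  assumes S: "open S" "convex S"
    and cont: "continuous_on (S \<times> sphere z e) (\<lambda>(x, y). f x y)"
    and hol: "\<And>y. y \<in> sphere z e \<Longrightarrow> (\<lambda>x. f x y) holomorphic_on S"
    and e: "e > 0"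
  shows "(\<lambda>x. contour_integral (circlepath z e) (f x)) holomorphic_on S"
proof -
  have circ: "circlepath z e u \<in> sphere z e" for u
    using e by (auto simp: circlepath dist_norm norm_mult)
  have c: "continuous_on UNIV (circlepath z e)"
    unfolding circlepath by (intro continuous_intros)
  have circ_cont: "continuous_on (S \<times> cbox 0 1) (\<lambda>w. circlepath z e (snd w))"
    by (rule continuous_on_compose2[OF c]) (auto intro: continuous_intros)
  have comp: "continuous_on (S \<times> cbox 0 1) (\<lambda>w. g (fst w) (circlepath z e (snd w)))"
    if "continuous_on (S \<times> sphere z e) (\<lambda>(x, y). g x y)" for g :: "complex \<Rightarrow> complex \<Rightarrow> complex"
  proof -
    have "continuous_on (S \<times> cbox 0 1) (\<lambda>w. (\<lambda>(x, y). g x y) (fst w, circlepath z e (snd w)))"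
      by (rule continuous_on_compose2[OF that])
         (use circ in \<open>auto intro!: continuous_intros circ_cont[simplified]\<close>)
    then show ?thesis by simp
  qed
  let ?v = "\<lambda>u. vector_derivative (circlepath z e) (at u)"
  have vcont: "continuous_on (S \<times> cbox 0 1) (\<lambda>w. ?v (snd w))"
    unfolding vector_derivative_circlepath by (intro continuous_intros)
  have "(\<lambda>x. integral (cbox 0 1) (\<lambda>u. f x (circlepath z e u) * ?v u)) holomorphic_on S"
  proof (rule leibniz_rule_holomorphic[where fx = "\<lambda>x u. deriv (\<lambda>x. f x (circlepath z e u)) x * ?v u"])
    show "((\<lambda>x. f x (circlepath z e t) * ?v t) has_field_derivative
           deriv (\<lambda>x. f x (circlepath z e t)) x * ?v t) (at x within S)" if "x \<in> S" for x t
      using holomorphic_derivI[OF hol[OF circ] S(1) that] by (rule DERIV_cmult_right)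
    show "(\<lambda>u. f x (circlepath z e u) * ?v u) integrable_on cbox 0 1" if "x \<in> S" for x
    proof (rule integrable_continuous)
      have "continuous_on (cbox 0 1) (\<lambda>u. (\<lambda>w. f (fst w) (circlepath z e (snd w)) * ?v (snd w)) (x, u))"
        by (rule continuous_on_compose2[OF continuous_on_mult[OF comp[OF cont] vcont]])
           (use that in \<open>auto intro: continuous_intros\<close>)
      then show "continuous_on (cbox 0 1) (\<lambda>u. f x (circlepath z e u) * ?v u)" by simp
    qed
    show "continuous_on (S \<times> cbox 0 1) (\<lambda>(x, t). deriv (\<lambda>x. f x (circlepath z e t)) x * ?v t)"
      using continuous_on_mult[OF comp[OF continuous_on_deriv_param[OF S(1) cont hol]] vcont]
      by (simp add: split_beta)
  qed (rule S)
  then show ?thesis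
    by (simp add: contour_integral_integral)
qed

text \<open>On open sets this is holomorphy in two variables, by Osgood's lemma. The form needs
  one-variable theory only, and joint continuity makes circle integrals depend well on a
  parameter.\<close>

definition sep_holomorphic_on ::
    "(complex \<Rightarrow> complex \<Rightarrow> complex) \<Rightarrow> complex set \<Rightarrow> complex set \<Rightarrow> bool" where
  "sep_holomorphic_on f S T \<longleftrightarrow> continuous_on (S \<times> T) (\<lambda>(x, y). f x y) \<and>
     (\<forall>y\<in>T. (\<lambda>x. f x y) holomorphic_on S) \<and> (\<forall>x\<in>S. f x holomorphic_on T)"

text \<open>Joint continuity is \<open>continuous_on_deriv_param\<close> with the variables swapped.
  Holomorphy in \<open>x\<close> comes from Cauchy's formula in \<open>y\<close>, whose integrand
  \<open>f x u / (u - y)\<^sup>2\<close> is holomorphic in \<open>x\<close>.\<close>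

lemma sep_holomorphic_on_deriv:
  assumes f: "sep_holomorphic_on f S T" and S: "open S" "convex S" and T: "open T"
  shows "sep_holomorphic_on (\<lambda>x. deriv (f x)) S T"
proof -
  have cont: "continuous_on (S \<times> T) (\<lambda>(x, y). f x y)"
    and hx: "\<And>y. y \<in> T \<Longrightarrow> (\<lambda>x. f x y) holomorphic_on S"
    and hy: "\<And>x. x \<in> S \<Longrightarrow> f x holomorphic_on T"
    using f by (auto simp: sep_holomorphic_on_def)
  have swap: "continuous_on (A \<times> B) (\<lambda>(x, y). g x y)" if "continuous_on (B \<times> A) (\<lambda>(y, x). g x y)"
    for A B :: "complex set" and g :: "complex \<Rightarrow> complex \<Rightarrow> complex"
  proof -
    have "continuous_on (A \<times> B) (\<lambda>w. (\<lambda>(y, x). g x y) (snd w, fst w))"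
      by (rule continuous_on_compose2[OF that]) (auto intro!: continuous_intros)
    then show ?thesis by (simp add: split_beta)
  qed
  have "continuous_on (T \<times> S) (\<lambda>(y, x). deriv (\<lambda>y. f x y) y)"
    by (rule continuous_on_deriv_param[OF T swap[OF cont] hy])
  then have 1: "continuous_on (S \<times> T) (\<lambda>(x, y). deriv (f x) y)"
    by (rule swap)
  have 2: "(\<lambda>x. deriv (f x) y) holomorphic_on S" if yT: "y \<in> T" for y
  proof -
    obtain e where e: "e > 0" "cball y e \<subseteq> T" using yT T open_contains_cball by blast
    have "(\<lambda>x. contour_integral (circlepath y e) (\<lambda>u. f x u / (u - y)\<^sup>2)) holomorphic_on S"
    proof (rule holomorphic_contour_integral_circlepath[OF S _ _ e(1)])
      have "continuous_on (S \<times> sphere y e) (\<lambda>w. (\<lambda>(x, y). f x y) w / (snd w - y)\<^sup>2)"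
        using e by (intro continuous_intros continuous_on_subset[OF cont]) auto
      then show "continuous_on (S \<times> sphere y e) (\<lambda>(x, u). f x u / (u - y)\<^sup>2)"
        by (simp add: split_beta)
      show "(\<lambda>x. f x u / (u - y)\<^sup>2) holomorphic_on S" if "u \<in> sphere y e" for u
        using that e by (intro holomorphic_intros hx) auto
    qed
    then have "(\<lambda>x. 1 / (2 * of_real pi * \<i>) *
        contour_integral (circlepath y e) (\<lambda>u. f x u / (u - y)\<^sup>2)) holomorphic_on S"
      by (intro holomorphic_intros) auto
    moreover have "deriv (f x) y = 1 / (2 * of_real pi * \<i>) *
        contour_integral (circlepath y e) (\<lambda>u. f x u / (u - y)\<^sup>2)" if "x \<in> S" for x
    proof -
      have "f x holomorphic_on cball y e"
        using hy[OF that] e(2) holomorphic_on_subset by blast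
      then have "continuous_on (cball y e) (f x)" "f x holomorphic_on ball y e"
        using holomorphic_on_imp_continuous_on holomorphic_on_subset ball_subset_cball by blast+
      from Cauchy_derivative_integral_circlepath(2)[OF this, of y]
      show ?thesis using e(1) by (simp add: DERIV_imp_deriv)
    qed
    ultimately show ?thesis by (metis (no_types, lifting) holomorphic_cong)
  qed
  show ?thesis
    unfolding sep_holomorphic_on_def using 1 2 hy T by (auto intro: holomorphic_intros)
qed

text \<open>The sum of \<open>exp (H x y)\<close> over the zeros \<open>y\<close> of \<open>q x\<close> near \<open>y0\<close> is holomorphic in \<open>x\<close> by the
  argument principle; were \<open>Re (H x y) < 0\<close> at all other common zeros, its modulus would have a strict
  maximum at \<open>x0\<close>.\<close>

lemma common_zero_Re_nonneg:
  assumes q: "sep_holomorphic_on q (ball x0 R) (ball y0 R)"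
    and H: "sep_holomorphic_on H (ball x0 R) (ball y0 R)"
    and R: "R > 0" and q0: "q x0 y0 = 0" and H0: "H x0 y0 = 0"
  shows "\<exists>x\<in>ball x0 R. \<exists>y\<in>ball y0 R. (x, y) \<noteq> (x0, y0) \<and> q x y = 0 \<and> Re (H x y) \<ge> 0"
proof (rule ccontr)
  assume "\<not> ?thesis"
  then have neg: "Re (H x y) < 0"
    if "x \<in> ball x0 R" "y \<in> ball y0 R" "(x, y) \<noteq> (x0, y0)" "q x y = 0" for x y
    using that by (meson not_le)
  have qcont: "continuous_on (ball x0 R \<times> ball y0 R) (\<lambda>(x, y). q x y)"
    and qy: "\<And>x. x \<in> ball x0 R \<Longrightarrow> q x holomorphic_on ball y0 R"
    and Hy: "\<And>x. x \<in> ball x0 R \<Longrightarrow> H x holomorphic_on ball y0 R"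
    using q H by (auto simp: sep_holomorphic_on_def)
  have x0: "x0 \<in> ball x0 R" and y0: "y0 \<in> ball y0 R" using R by auto
  show False
  proof (cases "\<forall>y\<in>ball y0 R. q x0 y = 0")
    \<comment> \<open>The whole slice \<open>x = x0\<close> consists of zeros, and the maximum
      principle for \<open>exp (H x0 y)\<close> on it already gives a contradiction.\<close>
    case True
    have le: "Re (H x0 y) \<le> 0" if "y \<in> ball y0 R" for y
      using neg[OF x0 that] True that H0 by (cases "y = y0") auto
    have "(\<lambda>y. exp (H x0 y)) constant_on ball y0 R"
      by (rule maximum_modulus_principle[of _ _ "ball y0 R" y0])
         (use le R H0 Hy[OF x0] in \<open>auto intro!: holomorphic_intros\<close>)
    moreover define y1 where "y1 = y0 + of_real (R/2)"
    moreover have y1: "y1 \<in> ball y0 R" "y1 \<noteq> y0" using R by (auto simp: y1_def dist_norm)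
    ultimately have "exp (H x0 y1) = exp (H x0 y0)" using y0 by (auto simp: constant_on_def)
    then have "Re (H x0 y1) = 0" using H0
      by (metis exp_zero norm_exp_eq_Re norm_one exp_eq_one_iff)
    then show False using neg[OF x0 y1(1)] True y1 by auto
  next
    case False
    then obtain b where b: "b \<in> ball y0 R" "q x0 b \<noteq> 0" by blast
    obtain r' where r': "0 < r'" "ball y0 r' \<subseteq> ball y0 R"
        and nz: "\<And>y. y \<in> ball y0 r' - {y0} \<Longrightarrow> q x0 y \<noteq> 0"
      using isolated_zeros[OF qy[OF x0] open_ball connected_ball y0 q0 b] by metis
    define r1 where "r1 = r' / 2"
    define r where "r = r1 / 2"
    have r: "0 < r" "r < r1" "0 < r1" "r1 < r'" using r' by (auto simp: r_def r1_def)
    \<comment> \<open>A whole annulus, not just one circle, is kept free of zeros: for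
      \<open>x\<close> near \<open>x0\<close> every zero in \<open>ball y0 r1\<close> then lies in
      \<open>ball y0 r\<close>, inside the contour.\<close>
    define A where "A = cball y0 r1 - ball y0 r"
    have A: "compact A" "A \<subseteq> ball y0 R" "A \<subseteq> ball y0 r' - {y0}"
      using r r'(2) by (auto simp: A_def compact_diff)
    have "open ((ball x0 R \<times> ball y0 R) \<inter> (\<lambda>(x, y). q x y) -` (- {0}))"
      by (rule continuous_open_preimage[OF qcont]) (auto intro: open_Times)
    then have W: "open {(x, y). x \<in> ball x0 R \<and> y \<in> ball y0 R \<and> q x y \<noteq> 0}"
      by (rule back_subst[of "open"]) auto
    have "q x0 y \<noteq> 0" if "y \<in> A" for y using that A(3) nz by blast
    then have xA: "{x0} \<times> A \<subseteq> {(x, y). x \<in> ball x0 R \<and> y \<in> ball y0 R \<and> q x y \<noteq> 0}"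
      using A(2) x0 by auto
    obtain X0 where X0: "x0 \<in> X0" "open X0"
        "X0 \<times> A \<subseteq> {(x, y). x \<in> ball x0 R \<and> y \<in> ball y0 R \<and> q x y \<noteq> 0}"
      using Elementary_Topology.tube_lemma[OF A(1) W xA] by (elim exE conjE)
    obtain \<rho> where \<rho>: "\<rho> > 0" "ball x0 \<rho> \<subseteq> X0 \<inter> ball x0 R"
      using X0(1,2) x0 by (meson IntI open_Int open_ball open_contains_ball)
    have nzA: "q x y \<noteq> 0" if "x \<in> ball x0 \<rho>" "y \<in> A" for x y
    proof -
      have "(x, y) \<in> X0 \<times> A" using that \<rho>(2) by auto
      then show ?thesis using X0(3) by blast
    qed
    have sub: "ball x0 \<rho> \<subseteq> ball x0 R" "sphere y0 r \<subseteq> ball y0 R" "ball y0 r1 \<subseteq> ball y0 R"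
        "sphere y0 r \<subseteq> A"
      using \<rho> r r' A by (auto simp: A_def)
    define pz where "pz = (\<lambda>x. {y\<in>ball y0 r1. q x y = 0})"
    define n where "n = (\<lambda>x. \<Sum>p\<in>pz x. zorder (q x) p)"
    have pz_sub: "pz x \<subseteq> ball y0 r" if "x \<in> ball x0 \<rho>" for x
      using nzA[OF that] by (force simp: pz_def A_def)
    have fin: "finite (pz x)" if "x \<in> ball x0 \<rho>" for x
    proof (cases "pz x = {}")
      case False
      then obtain y where y: "y \<in> ball y0 r1" "q x y = 0" by (auto simp: pz_def)
      have y1: "y0 + of_real r \<in> sphere y0 r" using r by (auto simp: dist_norm)
      then have "q x (y0 + of_real r) \<noteq> 0" using nzA[OF that] sub by blast
      then have "\<not> q x constant_on ball y0 R"
        using y y1 sub unfolding constant_on_def by (metis subsetD)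
      then have "finite {y\<in>cball y0 r1. q x y = 0}"
        using r r' that sub by (intro holomorphic_compact_finite_zeros[OF qy]) auto
      then show ?thesis by (rule finite_subset[rotated]) (auto simp: pz_def)
    qed auto
    \<comment> \<open>The argument principle with a weight: \<open>h = (\<lambda>_. 1)\<close>
      yields the number \<open>n x\<close> of zeros with multiplicity,
      \<open>h = (\<lambda>y. exp (H x y))\<close> the weighted sum \<open>F x\<close>.\<close>
    have arg: "contour_integral (circlepath y0 r) (\<lambda>y. deriv (q x) y * h y / q x y) =
        2 * pi * \<i> * (\<Sum>p\<in>pz x. h p * zorder (q x) p)"
      if x: "x \<in> ball x0 \<rho>" and h: "h holomorphic_on ball y0 R"
      for x and h :: "complex \<Rightarrow> complex"
    proof -
      have xR: "x \<in> ball x0 R" using x sub(1) by blast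
      have "contour_integral (circlepath y0 r) (\<lambda>y. deriv (q x) y * h y / q x y) =
        2 * pi * \<i> * (\<Sum>p\<in>{w\<in>ball y0 r1. q x w = 0 \<or> w \<in> {}}. winding_number (circlepath y0 r) p * h p * zorder (q x) p)"
      proof (rule argument_principle)
        show "q x holomorphic_on ball y0 r1 - {}" "h holomorphic_on ball y0 r1"
          using h qy[OF xR] sub(3) by (auto intro: holomorphic_on_subset)
        show "path_image (circlepath y0 r) \<subseteq> ball y0 r1 - {w\<in>ball y0 r1. q x w = 0 \<or> w \<in> {}}"
          using nzA[OF x] sub(4) r by (auto simp: subset_iff)
        show "\<forall>z. z \<notin> ball y0 r1 \<longrightarrow> winding_number (circlepath y0 r) z = 0"
          using r by (auto intro!: winding_number_zero_outside[of _ "cball y0 r"])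
        show "finite {w\<in>ball y0 r1. q x w = 0 \<or> w \<in> {}}" using fin[OF x] by (simp add: pz_def)
      qed auto
      also have "\<dots> = 2 * pi * \<i> * (\<Sum>p\<in>pz x. h p * zorder (q x) p)"
      proof -
        have "winding_number (circlepath y0 r) p = 1" if "p \<in> pz x" for p
          using pz_sub[OF x] that by (intro winding_number_circlepath) (auto simp: dist_norm norm_minus_commute)
        then show ?thesis by (simp add: pz_def)
      qed
      finally show ?thesis .
    qed
    have pos: "zorder (q x) p > 0" if x: "x \<in> ball x0 \<rho>" and p: "p \<in> pz x" for x p
    proof -
      have y1: "y0 + of_real r \<in> sphere y0 r" using r by (auto simp: dist_norm)
      then have "q x (y0 + of_real r) \<noteq> 0" using nzA[OF x] sub by blast
      moreover have "y0 + of_real r \<in> ball y0 R" using y1 sub by blast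
      ultimately have "if q x p = 0 then zorder (q x) p > 0 else zorder (q x) p = 0"
        using zorder_exist_zero[OF qy open_ball connected_ball, of x p] p sub(1,3) x
        unfolding pz_def by blast
      then show ?thesis using p by (simp add: pz_def)
    qed
    have intg_hol: "(\<lambda>x. contour_integral (circlepath y0 r) (\<lambda>y. deriv (q x) y * h x y / q x y)) holomorphic_on ball x0 \<rho>"
      if h: "sep_holomorphic_on h (ball x0 R) (ball y0 R)" for h
    proof (rule holomorphic_contour_integral_circlepath[OF open_ball convex_ball _ _ r(1)])
      have d: "sep_holomorphic_on (\<lambda>x. deriv (q x)) (ball x0 R) (ball y0 R)"
        by (rule sep_holomorphic_on_deriv[OF q]) auto
      have s: "ball x0 \<rho> \<times> sphere y0 r \<subseteq> ball x0 R \<times> ball y0 R" using sub by blast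
      have "continuous_on (ball x0 \<rho> \<times> sphere y0 r)
              (\<lambda>w. (\<lambda>(x, y). deriv (q x) y) w * (\<lambda>(x, y). h x y) w / (\<lambda>(x, y). q x y) w)"
        using d h nzA sub(4) unfolding sep_holomorphic_on_def
        by (intro continuous_intros continuous_on_subset[OF _ s] qcont) auto
      then show "continuous_on (ball x0 \<rho> \<times> sphere y0 r) (\<lambda>(x, y). deriv (q x) y * h x y / q x y)"
        by (simp add: split_beta)
      show "(\<lambda>x. deriv (q x) y * h x y / q x y) holomorphic_on ball x0 \<rho>" if "y \<in> sphere y0 r" for y
      proof -
        have y: "y \<in> ball y0 R" using that sub by blast
        have "(\<lambda>x. deriv (q x) y) holomorphic_on ball x0 \<rho>" "(\<lambda>x. h x y) holomorphic_on ball x0 \<rho>"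
            "(\<lambda>x. q x y) holomorphic_on ball x0 \<rho>"
          using d h q y sub(1) unfolding sep_holomorphic_on_def by (blast intro: holomorphic_on_subset)+
        then show ?thesis using nzA that sub(4) by (intro holomorphic_intros) auto
      qed
    qed
    \<comment> \<open>\<open>n\<close> is integer valued and, being a contour integral up to a
      factor, continuous on a connected set.\<close>
    have n_const: "n x = n x0" if "x \<in> ball x0 \<rho>" for x
    proof -
      let ?N = "\<lambda>x. contour_integral (circlepath y0 r) (\<lambda>y. deriv (q x) y * 1 / q x y) / (2 * pi * \<i>)"
      have eq: "?N x = of_int (n x)" if "x \<in> ball x0 \<rho>" for x
        using arg[OF that, of "\<lambda>_. 1"] by (simp add: n_def)
      have "sep_holomorphic_on (\<lambda>_ _. 1) (ball x0 R) (ball y0 R)"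
        by (auto simp: sep_holomorphic_on_def split_beta)
      then have "?N holomorphic_on ball x0 \<rho>" by (intro holomorphic_intros intg_hol) auto
      then have "continuous_on (ball x0 \<rho>) ?N" by (rule holomorphic_on_imp_continuous_on)
      moreover have "continuous_on (ball x0 \<rho>) ?N =
          continuous_on (ball x0 \<rho>) (\<lambda>x. of_int (n x) :: complex)"
        by (rule continuous_on_cong[OF refl eq])
      ultimately have c: "continuous_on (ball x0 \<rho>) (\<lambda>x. of_int (n x) :: complex)" by simp
      have "(\<lambda>x. of_int (n x) :: complex) constant_on ball x0 \<rho>"
      proof (rule continuous_discrete_range_constant[OF connected_ball c])
        fix x
        have "1 \<le> norm (of_int (n y) - of_int (n x) :: complex)" if "n y \<noteq> n x" for y
        proof -
          have "1 \<le> \<bar>n y - n x\<bar>" using that by simp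
          then have "1 \<le> \<bar>real_of_int (n y - n x)\<bar>" by linarith
          also have "\<dots> = norm (of_int (n y - n x) :: complex)" by (rule norm_of_int[symmetric])
          finally show ?thesis by simp
        qed
        then show "\<exists>e>0. \<forall>y. y \<in> ball x0 \<rho> \<and> (of_int (n y) :: complex) \<noteq> of_int (n x) \<longrightarrow>
            e \<le> norm (of_int (n y) - of_int (n x) :: complex)"
          by (intro exI[of _ 1]) auto
      qed
      then have "(of_int (n x) :: complex) = of_int (n x0)"
        using that \<rho>(1) unfolding constant_on_def by (metis centre_in_ball)
      then show ?thesis by simp
    qed
    define F where "F = (\<lambda>x. contour_integral (circlepath y0 r) (\<lambda>y. deriv (q x) y * exp (H x y) / q x y))"
    have expH: "sep_holomorphic_on (\<lambda>x y. exp (H x y)) (ball x0 R) (ball y0 R)"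
      using H unfolding sep_holomorphic_on_def
      by (auto intro!: holomorphic_intros continuous_intros simp: split_beta)
    have Fhol: "F holomorphic_on ball x0 \<rho>"
      unfolding F_def by (rule intg_hol[OF expH])
    have Feq: "F x = 2 * pi * \<i> * (\<Sum>p\<in>pz x. exp (H x p) * zorder (q x) p)" if "x \<in> ball x0 \<rho>" for x
      unfolding F_def
    proof (rule arg[OF that])
      show "(\<lambda>y. exp (H x y)) holomorphic_on ball y0 R"
        using that sub(1) by (intro holomorphic_intros Hy) auto
    qed
    have x0\<rho>: "x0 \<in> ball x0 \<rho>" using \<rho> by simp
    have pz0: "pz x0 = {y0}"
    proof -
      have "y = y0" if "y \<in> pz x0" for y
        using nz[of y] that r by (auto simp: pz_def)
      then show ?thesis using q0 r by (auto simp: pz_def)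
    qed
    have n0: "n x0 > 0" using pos[OF x0\<rho>] by (simp add: n_def pz0)
    have F0: "norm (F x0) = 2 * pi * n x0"
      using n0 by (simp add: Feq[OF x0\<rho>] pz0 H0 n_def norm_mult)
    \<comment> \<open>Off \<open>x0\<close> each zero contributes less in modulus than its
      multiplicity, while the multiplicities still add up to \<open>n x0\<close>.\<close>
    have Flt: "norm (F x) < 2 * pi * n x0" if x: "x \<in> ball x0 \<rho>" "x \<noteq> x0" for x
    proof -
      have ne: "pz x \<noteq> {}" using n_const[OF x(1)] n0 by (auto simp: n_def)
      have "norm (\<Sum>p\<in>pz x. exp (H x p) * zorder (q x) p) \<le> (\<Sum>p\<in>pz x. exp (Re (H x p)) * zorder (q x) p)"
        using pos[OF x(1)] by (intro sum_norm_le) (auto simp: norm_mult less_imp_le)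
      also have "\<dots> < (\<Sum>p\<in>pz x. real_of_int (zorder (q x) p))"
      proof (rule sum_strict_mono[OF fin[OF x(1)] ne])
        fix p assume p: "p \<in> pz x"
        have "Re (H x p) < 0"
          using p x sub by (intro neg) (auto simp: pz_def)
        then show "exp (Re (H x p)) * zorder (q x) p < real_of_int (zorder (q x) p)"
          using pos[OF x(1) p] by simp
      qed
      also have "\<dots> = n x" by (simp add: n_def)
      also have "\<dots> = n x0" using n_const[OF x(1)] by simp
      finally show ?thesis by (simp add: Feq[OF x(1)] norm_mult)
    qed
    have "F constant_on ball x0 \<rho>"
      by (rule maximum_modulus_principle[OF Fhol _ _ open_ball order.refl x0\<rho>])
         (use Flt F0 in \<open>auto intro: less_imp_le\<close>, metis less_eq_real_def)
    moreover define x1 where "x1 = x0 + of_real (\<rho>/2)"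
    moreover have x1: "x1 \<in> ball x0 \<rho>" "x1 \<noteq> x0" using \<rho> by (auto simp: x1_def dist_norm)
    ultimately have "F x1 = F x0" using x0\<rho> by (auto simp: constant_on_def)
    then show False using Flt[OF x1] F0 by simp
  qed
qed

section \<open>Thin shells\<close>

text \<open>A weak maximum principle, satisfied by positive-dimensional analytic sets: the functional
  \<open>\<lambda>w. w \<bullet> a\<close> is the real part of a complex linear one. It already rules out strict local
  maxima of \<open>(norm (w - c))\<^sup>2\<close>.\<close>

definition no_strict_max_on :: "'a::real_inner set \<Rightarrow> 'a set \<Rightarrow> bool" where
  "no_strict_max_on U Z \<longleftrightarrow>
     (\<forall>z\<in>Z \<inter> U. \<forall>a. \<forall>r>0. \<exists>w\<in>Z. w \<noteq> z \<and> dist w z < r \<and> 0 \<le> (w - z) \<bullet> a)"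

text \<open>Maximise \<open>\<phi>\<close> over \<open>Z \<inter> cball z \<eta>\<close>. Only half
  of \<open>(norm (w - z))\<^sup>2\<close> is subtracted, so \<open>\<phi>\<close> is still strictly
  convex and \<open>no_strict_max_on\<close> excludes an interior maximum; on the boundary sphere
  the subtracted term is exactly the claimed gain.\<close>

lemma no_strict_max_on_boundary:
  fixes Z :: "'a::euclidean_space set"
  assumes Z: "closed Z" "no_strict_max_on U Z" and z: "z \<in> Z" "cball z \<eta> \<subseteq> U" and \<eta>: "\<eta> > 0"
  shows "\<exists>w\<in>Z. dist w z = \<eta> \<and> \<eta>\<^sup>2 / 2 \<le> (norm (w - c))\<^sup>2 - (norm (z - c))\<^sup>2"
proof -
  define \<phi> where "\<phi> = (\<lambda>w. (norm (w - c))\<^sup>2 - (norm (w - z))\<^sup>2 / 2)"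
  have "compact (Z \<inter> cball z \<eta>)" using Z by (simp add: closed_Int_compact)
  moreover have "Z \<inter> cball z \<eta> \<noteq> {}" using z \<eta> by auto
  moreover have "continuous_on (Z \<inter> cball z \<eta>) \<phi>"
    unfolding \<phi>_def by (intro continuous_intros) auto
  ultimately obtain w where w': "w \<in> Z \<inter> cball z \<eta>" "\<forall>v\<in>Z \<inter> cball z \<eta>. \<phi> v \<le> \<phi> w"
    using continuous_attains_sup[of "Z \<inter> cball z \<eta>" \<phi>] by blast
  then have w: "w \<in> Z" "dist z w \<le> \<eta>" and max: "\<And>v. v \<in> Z \<inter> cball z \<eta> \<Longrightarrow> \<phi> v \<le> \<phi> w"
    by auto
  have "dist z w = \<eta>"
  proof (rule ccontr)
    assume "dist z w \<noteq> \<eta>"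
    then have pos: "\<eta> - dist z w > 0" using w by simp
    \<comment> \<open>The gradient of \<open>\<phi>\<close> at \<open>w\<close>; the remainder of
      the expansion is \<open>(norm (v - w))\<^sup>2 / 2\<close>, which is positive.\<close>
    define a where "a = 2 *\<^sub>R (w - c) - (w - z)"
    have "w \<in> Z \<inter> U" using w z by auto
    then obtain v where v: "v \<in> Z" "v \<noteq> w" "dist v w < \<eta> - dist z w" "0 \<le> (v - w) \<bullet> a"
      using Z(2) pos unfolding no_strict_max_on_def by blast
    have "\<phi> v - \<phi> w = (v - w) \<bullet> a + (norm (v - w))\<^sup>2 / 2"
      unfolding \<phi>_def a_def power2_norm_eq_inner
      by (simp add: inner_diff_left inner_diff_right inner_add_left inner_add_right inner_commute field_simps)
    moreover have "(norm (v - w))\<^sup>2 / 2 > 0" using v by simp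
    moreover have "dist z v \<le> \<eta>"
      using v(3) dist_triangle[of z v w] by (simp add: dist_commute)
    moreover from this have "\<phi> v \<le> \<phi> w" using v(1) by (intro max) simp
    ultimately show False using v(4) by linarith
  qed
  moreover have "\<phi> z \<le> \<phi> w" using max[of z] z \<eta> by simp
  ultimately show ?thesis
    using w by (intro bexI[of _ w]) (auto simp: \<phi>_def dist_norm norm_minus_commute)
qed

text \<open>The shell number \<open>k\<close> below has thickness of order \<open>(eta k)\<^sup>2\<close>; peeling off all later shells
  moves points by \<open>\<Sum>j>k. eta j\<close>, which is small compared with that.\<close>

primrec eta :: "nat \<Rightarrow> real" where
  "eta 0 = 1/4"
| "eta (Suc k) = (eta k)\<^sup>2 / 100"

lemma eta_bounds: "0 < eta k" "eta k \<le> 1/4"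
proof (induction k)
  case (Suc k)
  { case 1 show ?case using Suc by simp }
  { case 2
    have "(eta k)\<^sup>2 \<le> 1\<^sup>2" using Suc by (intro power_mono) auto
    then show ?case by simp }
qed auto

lemma sum_eta_le: "(\<Sum>j=k..<k+d. eta j) \<le> 2 * eta k"
proof (induction d arbitrary: k)
  case 0
  then show ?case using eta_bounds(1)[of k] by simp
next
  case (Suc d)
  have "(\<Sum>j=k..<k+Suc d. eta j) = eta k + (\<Sum>j=Suc k..<Suc k+d. eta j)"
    by (simp add: sum.atLeast_Suc_lessThan)
  also have "\<dots> \<le> eta k + 2 * eta (Suc k)" using Suc[of "Suc k"] by simp
  also have "\<dots> \<le> 2 * eta k"
    using mult_right_mono[OF eta_bounds(2)[of k], of "eta k"] eta_bounds[of k] by (simp add: power2_eq_square)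
  finally show ?case .
qed

text \<open>If \<open>Z\<close> were covered by finitely many shells, these could be discarded one at a time, the thinnest
  first: a point of \<open>Z\<close> cannot have all of \<open>Z\<close> near it in a single shell, since
  \<open>(norm (w - c))\<^sup>2\<close> has to grow along \<open>Z\<close>.\<close>

lemma no_strict_max_on_meets_shell_complement:
  fixes Z :: "'a::euclidean_space set" and c :: "nat \<Rightarrow> 'a" and r :: "nat \<Rightarrow> real"
  assumes Z: "closed Z" "no_strict_max_on (ball 0 1) Z" "0 \<in> Z"
    and c: "\<And>i. norm (c i) \<le> 2"
  shows "\<exists>z\<in>Z. norm z \<le> 1 \<and> (\<forall>i. (eta i)\<^sup>2 / 8 \<le> \<bar>(norm (z - c i))\<^sup>2 - (r i)\<^sup>2\<bar>)"
proof (rule ccontr)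
  assume neg: "\<not> ?thesis"
  define \<rho> where "\<rho> = (\<lambda>i z. (norm (z - c i))\<^sup>2 - (r i)\<^sup>2)"
  define W where "W = (\<lambda>i. {z. \<bar>\<rho> i z\<bar> < (eta i)\<^sup>2 / 8})"
  have cover: "Z \<inter> cball 0 1 \<subseteq> (\<Union>i\<in>UNIV. W i)"
  proof
    fix z assume "z \<in> Z \<inter> cball 0 1"
    then obtain i where "\<not> (eta i)\<^sup>2 / 8 \<le> \<bar>(norm (z - c i))\<^sup>2 - (r i)\<^sup>2\<bar>"
      using neg by auto
    then have "z \<in> W i" by (simp add: W_def \<rho>_def not_le)
    then show "z \<in> (\<Union>i\<in>UNIV. W i)" by blast
  qed
  have "compact (Z \<inter> cball 0 1)" using Z by (simp add: closed_Int_compact)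
  moreover have "open (W i)" for i
    unfolding W_def \<rho>_def by (intro open_Collect_less continuous_intros)
  ultimately obtain I where I: "finite I" "Z \<inter> cball 0 1 \<subseteq> (\<Union>i\<in>I. W i)"
    using compactE_image[OF _ _ cover] by (metis UNIV_I)
  then obtain m where m: "I \<subseteq> {..<m}" using finite_nat_iff_bounded by blast
  \<comment> \<open>Both \<open>z - c i\<close> and \<open>w - c i\<close> have norm at most 3,
    whence the constant 6.\<close>
  have lip: "\<bar>\<rho> i z\<bar> \<le> \<bar>\<rho> i w\<bar> + 6 * dist w z" if "norm z \<le> 1" "norm w \<le> 1" for i w z
  proof -
    have "\<rho> i z - \<rho> i w = (z - w) \<bullet> (z - c i + (w - c i))"
      unfolding \<rho>_def power2_norm_eq_inner
      by (simp add: inner_diff_left inner_diff_right inner_add_right inner_commute algebra_simps)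
    then have "\<bar>\<rho> i z - \<rho> i w\<bar> \<le> norm (z - w) * norm (z - c i + (w - c i))"
      by (simp add: Cauchy_Schwarz_ineq2)
    also have "\<dots> \<le> norm (z - w) * 6"
      using that c[of i] norm_triangle_ineq[of "z - c i" "w - c i"]
        norm_triangle_ineq4[of z "c i"] norm_triangle_ineq4[of w "c i"]
      by (intro mult_left_mono) auto
    finally have "\<bar>\<rho> i z - \<rho> i w\<bar> \<le> 6 * dist w z"
      by (simp add: dist_norm norm_minus_commute mult.commute)
    then show ?thesis by simp
  qed
  define s where "s = (\<lambda>k. \<Sum>j=k..<m. eta j)"
  have s_le: "s k \<le> 2 * eta k" for k
    using sum_eta_le[of k "m - k"] eta_bounds(1)[of k] by (cases "k \<le> m") (auto simp: s_def)
  have s_nonneg: "s k \<ge> 0" for k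
    unfolding s_def using eta_bounds(1) by (intro sum_nonneg) (simp add: less_imp_le)
  \<comment> \<open>Invariant of the peeling: at distance more than \<open>s k\<close> from the unit
    sphere, the shells below \<open>k\<close>, slightly thickened, still cover \<open>Z\<close>. For
    \<open>k = 0\<close> no shell is left to contain the point \<open>0\<close>.\<close>
  have peel: "\<exists>i<k. \<bar>\<rho> i z\<bar> < (eta i)\<^sup>2 / 8 + 6 * s k"
    if "k \<le> m" "z \<in> Z" "norm z + s k < 1" for k z
    using that
  proof (induction arbitrary: z rule: inc_induct)
    case base
    then show ?case using I(2) m by (fastforce simp: s_def W_def)
  next
    case (step k)
    have sk: "s k = eta k + s (Suc k)"
      using step.hyps by (simp add: s_def sum.atLeast_Suc_lessThan)
    have nz: "norm z + eta k < 1" using step.prems s_nonneg[of "Suc k"] sk by simp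
    have nw: "norm w \<le> norm z + eta k" if "dist w z \<le> eta k" for w
      using that norm_triangle_sub[of w z] by (simp add: dist_norm)
    show ?case
    proof (rule ccontr)
      assume none: "\<not> ?case"
      \<comment> \<open>As \<open>z\<close> lies in none of the thickened shells below
        \<open>k\<close>, all points of \<open>Z\<close> within \<open>eta k\<close> of
        \<open>z\<close> must lie in the thickened shell \<open>k\<close>.\<close>
      have near: "\<bar>\<rho> k w\<bar> < (eta k)\<^sup>2 / 8 + 6 * s (Suc k)" if w: "w \<in> Z" "dist w z \<le> eta k" for w
      proof -
        have "norm w + s (Suc k) < 1" using nw[OF w(2)] step.prems sk by simp
        then obtain i where i: "i < Suc k" "\<bar>\<rho> i w\<bar> < (eta i)\<^sup>2 / 8 + 6 * s (Suc k)"
          using step.IH w by blast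
        have "\<bar>\<rho> i z\<bar> \<le> \<bar>\<rho> i w\<bar> + 6 * dist w z"
          using nw[OF w(2)] nz eta_bounds(1)[of k] by (intro lip) auto
        then have "\<bar>\<rho> i z\<bar> < (eta i)\<^sup>2 / 8 + 6 * s k" using i w sk by simp
        then have "i = k" using none i by (metis less_SucE)
        then show ?thesis using i by simp
      qed
      have "cball z (eta k) \<subseteq> ball 0 1"
        using nw nz by (force simp: dist_commute)
      then obtain w where w: "w \<in> Z" "dist w z = eta k"
          "(eta k)\<^sup>2 / 2 \<le> (norm (w - c k))\<^sup>2 - (norm (z - c k))\<^sup>2"
        using no_strict_max_on_boundary[OF Z(1,2) step.prems(1)] eta_bounds(1) by blast
      \<comment> \<open>The forced growth \<open>(eta k)\<^sup>2 / 2\<close> exceeds the variation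
        permitted inside the thickened shell, which is at most 0.49 times
        \<open>(eta k)\<^sup>2\<close>.\<close>
      have "(eta k)\<^sup>2 / 2 \<le> \<rho> k w - \<rho> k z" using w by (simp add: \<rho>_def)
      also have "\<dots> < 2 * ((eta k)\<^sup>2 / 8 + 6 * s (Suc k))"
        using near[OF w(1)] near[OF step.prems(1)] w eta_bounds(1)[of k] by (simp add: less_imp_le)
      also have "\<dots> \<le> 2 * ((eta k)\<^sup>2 / 8 + 12 * ((eta k)\<^sup>2 / 100))"
        using s_le[of "Suc k"] by simp
      finally show False using eta_bounds(1)[of k] by simp
    qed
  qed
  have "s 0 < 1" using s_le[of 0] by simp
  then show False using peel[of 0 0] Z(3) by simp
qed

text \<open>\<open>X0\<close> avoids a shell around the boundary of each ball \<open>B i\<close>, so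
  open and closed ball have the same trace on it, which is therefore clopen in \<open>X0\<close>.
  Dense centres and small rational radii separate points.\<close>

lemma totally_disconnected_barrier:
  obtains X0 :: "'a::euclidean_space set" and B :: "nat \<Rightarrow> 'a set"
  where "compact X0" "X0 \<subseteq> cball 0 1" "0 \<notin> X0"
    "\<And>i. open (B i)" "\<And>i. closed (X0 \<inter> B i)"
    "\<And>x y. x \<in> X0 \<Longrightarrow> y \<in> X0 \<Longrightarrow> x \<noteq> y \<Longrightarrow> \<exists>i. x \<in> B i \<and> y \<notin> B i"
    "\<And>Z. closed Z \<Longrightarrow> no_strict_max_on (ball 0 1) Z \<Longrightarrow> 0 \<in> Z \<Longrightarrow> Z \<inter> X0 \<noteq> {}"
proof -
  obtain D :: "'a set" where D: "countable D" "\<And>X. open X \<Longrightarrow> X \<noteq> {} \<Longrightarrow> \<exists>d\<in>D. d \<in> X"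
    by (rule countable_dense_setE) blast
  obtain b :: 'a where b: "b \<in> Basis" using nonempty_Basis by blast
  \<comment> \<open>The extra sphere of radius 1 about \<open>b\<close> passes through
    \<open>0\<close> and so expels \<open>0\<close> from \<open>X0\<close>. The bound 2 on the
    centres is the one assumed by the shell lemma and leaves room for centres near every point of
    the unit ball.\<close>
  define P where "P = insert (b, 1 :: real) ((D \<inter> cball 0 2) \<times> {r \<in> \<rat>. r > 0})"
  have P: "countable P" "P \<noteq> {}"
    using D(1) countable_rat by (auto simp: P_def intro: countable_subset[OF _ countable_rat])
  define f where "f = from_nat_into P"
  have f: "range f = P" unfolding f_def using P(2,1) by (rule range_from_nat_into)
  define c where "c = (\<lambda>i. fst (f i))"
  define r where "r = (\<lambda>i. snd (f i))"
  have cr: "(c i, r i) \<in> P" for i using f by (auto simp: c_def r_def)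
  have ex: "\<exists>i. c i = u \<and> r i = v" if uv: "(u, v) \<in> P" for u v
  proof -
    obtain i where "f i = (u, v)" using uv f by (metis imageE)
    then show ?thesis by (intro exI[of _ i]) (simp add: c_def r_def)
  qed
  have c2: "norm (c i) \<le> 2" and r0: "r i > 0" for i
    using cr[of i] b by (auto simp: P_def)
  define X0 where "X0 = {z. norm z \<le> 1 \<and> (\<forall>i. (eta i)\<^sup>2 / 8 \<le> \<bar>(norm (z - c i))\<^sup>2 - (r i)\<^sup>2\<bar>)}"
  define B where "B = (\<lambda>i. ball (c i) (r i))"
  have "closed X0"
    unfolding X0_def
    by (intro closed_Collect_conj closed_Collect_all closed_Collect_le continuous_intros)
  then have "compact X0"
    unfolding compact_eq_bounded_closed by (auto simp: X0_def bounded_iff)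
  moreover have "0 \<notin> X0"
  proof
    assume "0 \<in> X0"
    moreover obtain i where i: "c i = b" "r i = 1" using ex[of b 1] by (auto simp: P_def)
    ultimately have "(eta i)\<^sup>2 / 8 \<le> \<bar>(norm (0 - b))\<^sup>2 - 1\<^sup>2\<bar>" unfolding X0_def by (metis (mono_tags, lifting) mem_Collect_eq)
    then show False using b eta_bounds(1)[of i] by simp
  qed
  moreover have "closed (X0 \<inter> B i)" for i
  proof -
    have "X0 \<inter> B i = X0 \<inter> cball (c i) (r i)"
    proof -
      have "dist (c i) z \<noteq> r i" if "z \<in> X0" for z
      proof
        assume "dist (c i) z = r i"
        then have "(norm (z - c i))\<^sup>2 - (r i)\<^sup>2 = 0" by (simp add: dist_norm norm_minus_commute)
        moreover have "(eta i)\<^sup>2 / 8 \<le> \<bar>(norm (z - c i))\<^sup>2 - (r i)\<^sup>2\<bar>" using that by (simp add: X0_def)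
        ultimately show False using eta_bounds(1)[of i] by simp
      qed
      then show ?thesis unfolding B_def by force
    qed
    then show ?thesis using \<open>closed X0\<close> by (simp add: closed_Int)
  qed
  moreover have "\<exists>i. x \<in> B i \<and> y \<notin> B i" if xy: "x \<in> X0" "y \<in> X0" "x \<noteq> y" for x y
  proof -
    obtain q where q: "q \<in> \<rat>" "0 < q" "q < min 1 (dist x y / 2)"
      using Rats_dense_in_real[of 0 "min 1 (dist x y / 2)"] xy by auto
    obtain d where d: "d \<in> D" "dist x d < q" using D(2)[of "ball x q"] q by auto
    have "norm d \<le> 2"
      using d q xy(1) norm_triangle_sub[of d x] by (simp add: X0_def dist_norm norm_minus_commute)
    then obtain i where i: "c i = d" "r i = q" using ex[of d q] d q by (auto simp: P_def)
    have "x \<in> B i" using d by (simp add: B_def i dist_commute)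
    moreover have "y \<notin> B i"
      using d q dist_triangle[of x y d] by (auto simp: B_def i)
    ultimately show ?thesis by blast
  qed
  moreover have "Z \<inter> X0 \<noteq> {}" if "closed Z" "no_strict_max_on (ball 0 1) Z" "0 \<in> Z" for Z
    using no_strict_max_on_meets_shell_complement[where c = c and r = r, OF that c2] unfolding X0_def by blast
  moreover have "X0 \<subseteq> cball 0 1" by (auto simp: X0_def)
  moreover have "open (B i)" for i by (simp add: B_def)
  ultimately show ?thesis using that by blast
qed

section \<open>The tower of entire functions\<close>

lemma continuous_on_box_nhd:
  fixes F :: "complex \<times> complex \<Rightarrow> 'a::topological_space"
  assumes "continuous_on (ball x0 R \<times> ball y0 R) F" "R > 0" "open U" "F (x0, y0) \<in> U"
  obtains R' where "0 < R'" "R' \<le> R" "\<And>x y. x \<in> ball x0 R' \<Longrightarrow> y \<in> ball y0 R' \<Longrightarrow> F (x, y) \<in> U"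
proof -
  have "open ((ball x0 R \<times> ball y0 R) \<inter> F -` U)"
    using assms by (intro continuous_open_preimage) (auto intro: open_Times)
  moreover have "(x0, y0) \<in> (ball x0 R \<times> ball y0 R) \<inter> F -` U" using assms by auto
  ultimately obtain A B where AB: "open A" "open B" "(x0, y0) \<in> A \<times> B"
      "A \<times> B \<subseteq> (ball x0 R \<times> ball y0 R) \<inter> F -` U"
    by (rule open_prod_elim)
  obtain r1 where r1: "r1 > 0" "ball x0 r1 \<subseteq> A" using AB open_contains_ball by blast
  obtain r2 where r2: "r2 > 0" "ball y0 r2 \<subseteq> B" using AB open_contains_ball by blast
  show thesis
  proof (rule that[of "min R (min r1 r2)"])
    fix x y assume "x \<in> ball x0 (min R (min r1 r2))" "y \<in> ball y0 (min R (min r1 r2))"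
    then have "(x, y) \<in> A \<times> B" using r1 r2 by auto
    then show "F (x, y) \<in> U" using AB by blast
  qed (use assms r1 r2 in auto)
qed

lemma sep_holomorphic_on_const: "sep_holomorphic_on (\<lambda>_ _. c) S T"
  and sep_holomorphic_on_fst: "sep_holomorphic_on (\<lambda>x _. x) S T"
  and sep_holomorphic_on_snd: "sep_holomorphic_on (\<lambda>_ y. y) S T"
  by (auto simp: sep_holomorphic_on_def split_beta intro!: continuous_intros)

lemma sep_holomorphic_on_add:
    "sep_holomorphic_on f S T \<Longrightarrow> sep_holomorphic_on g S T \<Longrightarrow> sep_holomorphic_on (\<lambda>x y. f x y + g x y) S T"
  and sep_holomorphic_on_diff:
    "sep_holomorphic_on f S T \<Longrightarrow> sep_holomorphic_on g S T \<Longrightarrow> sep_holomorphic_on (\<lambda>x y. f x y - g x y) S T"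
  and sep_holomorphic_on_mult:
    "sep_holomorphic_on f S T \<Longrightarrow> sep_holomorphic_on g S T \<Longrightarrow> sep_holomorphic_on (\<lambda>x y. f x y * g x y) S T"
  by (auto simp: sep_holomorphic_on_def split_beta intro!: continuous_intros holomorphic_intros)

lemma sep_holomorphic_on_compose:
  assumes f: "sep_holomorphic_on f S T" and h: "h holomorphic_on U"
    and U: "\<And>x y. x \<in> S \<Longrightarrow> y \<in> T \<Longrightarrow> f x y \<in> U"
  shows "sep_holomorphic_on (\<lambda>x y. h (f x y)) S T"
proof -
  have "continuous_on (S \<times> T) (\<lambda>w. h ((\<lambda>(x, y). f x y) w))"
    by (rule continuous_on_compose2[OF holomorphic_on_imp_continuous_on[OF h]])
       (use f U in \<open>auto simp: sep_holomorphic_on_def\<close>)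
  moreover have "(\<lambda>x. h (f x y)) holomorphic_on S" if "y \<in> T" for y
    using holomorphic_on_compose_gen[OF _ h, of "\<lambda>x. f x y" S] f U that
    by (auto simp: sep_holomorphic_on_def o_def)
  moreover have "(\<lambda>y. h (f x y)) holomorphic_on T" if "x \<in> S" for x
    using holomorphic_on_compose_gen[OF _ h, of "f x" T] f U that
    by (auto simp: sep_holomorphic_on_def o_def)
  ultimately show ?thesis by (auto simp: sep_holomorphic_on_def split_beta)
qed

lemma sep_holomorphic_on_subset:
  assumes "sep_holomorphic_on f S T" "S' \<subseteq> S" "T' \<subseteq> T"
  shows "sep_holomorphic_on f S' T'"
proof -
  have "S' \<times> T' \<subseteq> S \<times> T" using assms by blast
  then show ?thesis
    using assms unfolding sep_holomorphic_on_def
    by (blast intro: continuous_on_subset holomorphic_on_subset)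
qed

lemmas sep_holomorphic_intros = sep_holomorphic_on_const sep_holomorphic_on_fst sep_holomorphic_on_snd
  sep_holomorphic_on_add sep_holomorphic_on_diff sep_holomorphic_on_mult

text \<open>Entire functions on \<open>\<complex>\<^sup>3\<close>, in the only form needed: continuous and holomorphic along
  holomorphic curves.\<close>

definition entire3 :: "(complex \<times> complex \<times> complex \<Rightarrow> complex) \<Rightarrow> bool" where
  "entire3 q \<longleftrightarrow> continuous_on UNIV q \<and>
     (\<forall>S f g h. open S \<longrightarrow> f holomorphic_on S \<longrightarrow> g holomorphic_on S \<longrightarrow> h holomorphic_on S \<longrightarrow>
        (\<lambda>w. q (f w, g w, h w)) holomorphic_on S)"

text \<open>Cauchy's estimate for \<open>exp (\<i> * Ln g)\<close>, which is bounded because \<open>Im (Ln g)\<close> is.\<close>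

lemma halfplane_deriv_bound:
  assumes g: "g holomorphic_on cball w r" and r: "r > 0" and Re: "\<And>z. z \<in> cball w r \<Longrightarrow> Re (g z) > 0"
  shows "norm (deriv g w) \<le> exp pi / r * norm (g w)"
proof -
  define f where "f = (\<lambda>z. exp (\<i> * Ln (g z)))"
  have nn: "g z \<notin> \<real>\<^sub>\<le>\<^sub>0" "g z \<noteq> 0" if "z \<in> cball w r" for z
    using Re[OF that] by (auto simp: complex_nonpos_Reals_iff)
  have hf: "f holomorphic_on cball w r"
    unfolding f_def using nn by (intro holomorphic_intros g) auto
  have n: "exp (- (pi/2)) \<le> norm (f z)" "norm (f z) \<le> exp (pi/2)" if "z \<in> cball w r" for z
  proof -
    have "\<bar>Im (Ln (g z))\<bar> < pi/2" using Re[OF that] nn[OF that] Re_Ln_pos_lt by blast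
    then show "exp (- (pi/2)) \<le> norm (f z)" "norm (f z) \<le> exp (pi/2)" by (auto simp: f_def)
  qed
  have "norm ((deriv ^^ 1) f w) \<le> fact 1 * exp (pi/2) / r ^ 1"
  proof (rule Cauchy_inequality)
    show "f holomorphic_on ball w r" "continuous_on (cball w r) f"
      using hf holomorphic_on_subset ball_subset_cball holomorphic_on_imp_continuous_on by blast+
    show "norm (f x) \<le> exp (pi/2)" if "norm (w - x) = r" for x
      using that by (intro n) (auto simp: dist_norm)
  qed (rule r)
  then have 1: "norm (deriv f w) \<le> exp (pi/2) / r" by simp
  have w: "w \<in> cball w r" "w \<in> ball w r" using r by auto
  have "(g has_field_derivative deriv g w) (at w)"
    using g w ball_subset_cball by (meson holomorphic_derivI holomorphic_on_subset open_ball)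
  then have "(f has_field_derivative f w * (\<i> * (deriv g w / g w))) (at w)"
    unfolding f_def using nn[OF w(1)] by (auto intro!: derivative_eq_intros simp: field_simps)
  then have "norm (deriv f w) = norm (f w) * (norm (deriv g w) / norm (g w))"
    by (simp add: DERIV_imp_deriv norm_mult norm_divide)
  then have "exp (- (pi/2)) * (norm (deriv g w) / norm (g w)) \<le> exp (pi/2) / r"
    using 1 n(1)[OF w(1)] mult_right_mono[of "exp (- (pi/2))" "norm (f w)" "norm (deriv g w) / norm (g w)"] by simp
  then have "exp (pi/2) * (exp (- (pi/2)) * (norm (deriv g w) / norm (g w))) \<le> exp (pi/2) * (exp (pi/2) / r)"
    by (intro mult_left_mono) auto
  then have "norm (deriv g w) / norm (g w) \<le> exp pi / r"
    by (simp add: mult.assoc[symmetric] mult_exp_exp)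
  then show ?thesis using nn[OF w(1)] by (simp add: field_simps)
qed

section \<open>The tower functions \<open>P k\<close> and their level sets\<close>

locale tower =
  fixes a :: "nat \<Rightarrow> complex" and first :: "nat \<Rightarrow> bool"
  assumes a_nz: "a k \<noteq> 0"
begin

text \<open>Normalised to be 1 at the origin, with its zeros where the coordinate selected by
  \<open>first k\<close> equals \<open>a k\<close>. Hence \<open>P (Suc k)\<close> can be nonzero on
  a set only if that coordinate omits \<open>a k\<close> there.\<close>

definition lin :: "nat \<Rightarrow> complex \<Rightarrow> complex \<Rightarrow> complex" where
  "lin k x y = 1 - (if first k then x else y) / a k"

text \<open>Four times the bound \<open>1 + 1 / norm (a k)\<close> for
  \<open>norm (lin k x y)\<close> when \<open>norm x\<close> and \<open>norm y\<close> are at most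
  1. The size serves \<open>Re_P_descend\<close>; that it is at least 4 makes derivatives double
  from one \<open>P k\<close> to the next.\<close>

definition m :: "nat \<Rightarrow> real" where
  "m k = 4 + 4 / norm (a k)"

primrec P :: "nat \<Rightarrow> complex \<Rightarrow> complex \<Rightarrow> complex \<Rightarrow> complex" where
  "P 0 x y t = 1 + t"
| "P (Suc k) x y t = lin k x y * exp (of_real (m k) * (P k x y t - 1))"

lemma m_ge: "m k \<ge> 4" by (simp add: m_def)

lemma P_0: "P k 0 0 0 = 1"
  by (induction k) (auto simp: lin_def)

lemma continuous_on_P: "continuous_on UNIV (\<lambda>z. P k (fst z) (fst (snd z)) (snd (snd z)))"
proof (induction k)
  case (Suc k)
  have "continuous_on UNIV (\<lambda>z::complex \<times> complex \<times> complex. lin k (fst z) (fst (snd z)))"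
    unfolding lin_def by (cases "first k") (auto intro!: continuous_intros simp: a_nz)
  then show ?case using Suc by (auto intro!: continuous_intros)
qed (auto intro!: continuous_intros)

text \<open>By contraposition: where \<open>Re (P k x y t) < 1/2\<close>, the exponential factor is
  at most \<open>exp (- 2 * b)\<close>, and
  \<open>b * exp (- 2 * b) \<le> b / (1 + 2 * b) < 1/2\<close> bounds \<open>P (Suc k)\<close> in
  modulus.\<close>

lemma Re_P_descend:
  assumes "norm x \<le> 1" "norm y \<le> 1" "1/2 \<le> Re (P (Suc k) x y t)"
  shows "1/2 \<le> Re (P k x y t)"
proof (rule ccontr)
  assume neg: "\<not> ?thesis"
  define b where "b = 1 + 1 / norm (a k)"
  have b: "b \<ge> 1" "m k = 4 * b" by (auto simp: b_def m_def)
  have "norm (lin k x y) \<le> 1 + norm ((if first k then x else y) / a k)"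
    unfolding lin_def by (metis norm_one norm_triangle_ineq4)
  also have "\<dots> \<le> b" using assms by (auto simp: b_def norm_divide divide_right_mono)
  finally have l: "norm (lin k x y) \<le> b" .
  have "norm (P (Suc k) x y t) = norm (lin k x y) * exp (m k * (Re (P k x y t) - 1))"
    by (simp add: norm_mult)
  also have "\<dots> \<le> b * exp (- 2 * b)"
  proof (intro mult_mono l)
    have "m k * (Re (P k x y t) - 1) \<le> m k * (- 1/2)"
      using neg m_ge[of k] by (intro mult_left_mono) auto
    then show "exp (m k * (Re (P k x y t) - 1)) \<le> exp (- 2 * b)" by (simp add: b)
  qed (use b in auto)
  also have "\<dots> \<le> b / (1 + 2 * b)"
  proof -
    have "exp (- 2 * b) \<le> 1 / (1 + 2 * b)"
      using b exp_ge_add_one_self[of "2 * b"] by (simp add: exp_minus field_simps)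
    then show ?thesis using b mult_left_mono[of "exp (- 2 * b)" "1 / (1 + 2 * b)" b] by simp
  qed
  also have "\<dots> < 1/2" using b by (simp add: field_simps)
  finally show False using assms(3) complex_Re_le_cmod[of "P (Suc k) x y t"] by linarith
qed

lemma Re_P_ge:
  assumes "norm x \<le> 1" "norm y \<le> 1" "1/2 \<le> Re (P k x y t)" "j \<le> k"
  shows "1/2 \<le> Re (P j x y t)"
  using assms(4,3)
proof (induction rule: inc_induct)
  case (step n)
  then show ?case using Re_P_descend[OF assms(1,2)] by blast
qed auto

text \<open>Near a point where no \<open>P j\<close> vanishes, the equation \<open>P k x y t = g x y\<close> is solved for \<open>t\<close> by taking
  logarithms \<open>k\<close> times.\<close>

lemma local_graph:
  assumes "\<And>j. j \<le> k \<Longrightarrow> P j x0 y0 t0 \<noteq> 0"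
    and "sep_holomorphic_on g (ball x0 R) (ball y0 R)" "R > 0" "g x0 y0 = P k x0 y0 t0"
  shows "\<exists>R'>0. \<exists>T. sep_holomorphic_on T (ball x0 R') (ball y0 R') \<and> T x0 y0 = t0 \<and>
           (\<forall>x\<in>ball x0 R'. \<forall>y\<in>ball y0 R'. P k x y (T x y) = g x y)"
  using assms
proof (induction k arbitrary: g R)
  case 0
  then show ?case
    by (intro exI[of _ R] conjI exI[of _ "\<lambda>x y. g x y - 1"]) (auto intro!: sep_holomorphic_intros)
next
  case (Suc k)
  define c where "c = P (Suc k) x0 y0 t0"
  define l0 where "l0 = lin k x0 y0"
  have nz: "c \<noteq> 0" "l0 \<noteq> 0" using Suc.prems(1)[of "Suc k"] by (auto simp: c_def l0_def)
  have gc0: "g x0 y0 = c" using Suc.prems(4) by (simp add: c_def)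
  have lin: "sep_holomorphic_on (\<lambda>x y. lin k x y * inverse l0) S T" for S T
    unfolding lin_def divide_inverse by (cases "first k") (auto intro!: sep_holomorphic_intros)
  have gc: "sep_holomorphic_on (\<lambda>x y. g x y * inverse c) (ball x0 R) (ball y0 R)"
    by (intro sep_holomorphic_intros Suc.prems)
  \<comment> \<open>Dividing by the value at the base point puts the argument of \<open>Ln\<close>
    into \<open>ball 1 1\<close>, away from the branch cut; the same is done for \<open>lin\<close>
    with \<open>R2\<close>.\<close>
  obtain R1 where R1: "0 < R1" "R1 \<le> R"
      "\<And>x y. x \<in> ball x0 R1 \<Longrightarrow> y \<in> ball y0 R1 \<Longrightarrow> (\<lambda>(x, y). g x y * inverse c) (x, y) \<in> ball 1 1"
    by (rule continuous_on_box_nhd[of x0 R y0 "\<lambda>(x, y). g x y * inverse c" "ball 1 1"])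
       (use gc Suc.prems(3) nz gc0 in \<open>auto simp: sep_holomorphic_on_def\<close>)
  obtain R2 where R2: "0 < R2" "R2 \<le> R1"
      "\<And>x y. x \<in> ball x0 R2 \<Longrightarrow> y \<in> ball y0 R2 \<Longrightarrow> (\<lambda>(x, y). lin k x y * inverse l0) (x, y) \<in> ball 1 1"
    by (rule continuous_on_box_nhd[of x0 R1 y0 "\<lambda>(x, y). lin k x y * inverse l0" "ball 1 1"])
       (use lin[of "ball x0 R1" "ball y0 R1"] R1 nz in \<open>auto simp: sep_holomorphic_on_def l0_def[symmetric]\<close>)
  have Ln: "Ln holomorphic_on ball 1 1"
  proof (rule holomorphic_on_Ln)
    show "ball (1::complex) 1 \<inter> \<real>\<^sub>\<le>\<^sub>0 = {}"
    proof -
      have "z \<notin> \<real>\<^sub>\<le>\<^sub>0" if "z \<in> ball 1 1" for z :: complex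
        using that complex_Re_le_cmod[of "1 - z"] by (auto simp: dist_norm complex_nonpos_Reals_iff)
      then show ?thesis by blast
    qed
  qed
  have nz1: "z \<noteq> 0" if "z \<in> ball 1 (1::real)" for z :: complex using that by auto
  \<comment> \<open>The solution for \<open>P k\<close> of
    \<open>lin k x y * exp (m k * (P k x y t - 1)) = g x y\<close>, on the branch of the logarithm
    with the right value at the base point.\<close>
  define g' where "g' = (\<lambda>x y. P k x0 y0 t0 +
      inverse (of_real (m k)) * (Ln (g x y * inverse c) - Ln (lin k x y * inverse l0)))"
  have "sep_holomorphic_on g' (ball x0 R2) (ball y0 R2)"
    unfolding g'_def
  proof (intro sep_holomorphic_intros)
    show "sep_holomorphic_on (\<lambda>x y. Ln (g x y * inverse c)) (ball x0 R2) (ball y0 R2)"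
      by (rule sep_holomorphic_on_compose[OF sep_holomorphic_on_subset[OF gc] Ln])
         (use R1 R2 in auto)
    show "sep_holomorphic_on (\<lambda>x y. Ln (lin k x y * inverse l0)) (ball x0 R2) (ball y0 R2)"
      by (rule sep_holomorphic_on_compose[OF lin Ln]) (use R2 in auto)
  qed
  moreover have "g' x0 y0 = P k x0 y0 t0"
    using nz by (simp add: g'_def gc0 l0_def[symmetric])
  ultimately obtain R' T where T: "R' > 0" "sep_holomorphic_on T (ball x0 R') (ball y0 R')"
      "T x0 y0 = t0" "\<And>x y. x \<in> ball x0 R' \<Longrightarrow> y \<in> ball y0 R' \<Longrightarrow> P k x y (T x y) = g' x y"
    using Suc.IH[of g' R2] Suc.prems(1) R2(1) by (metis le_SucI)
  define R3 where "R3 = min R' R2"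
  have "P (Suc k) x y (T x y) = g x y" if xy: "x \<in> ball x0 R3" "y \<in> ball y0 R3" for x y
  proof -
    have mk: "of_real (m k) \<noteq> (0::complex)" using m_ge[of k] by simp
    have 1: "g x y * inverse c \<noteq> 0" "lin k x y * inverse l0 \<noteq> 0"
      using R1(3)[of x y, simplified] R2(2) R2(3)[of x y, simplified] xy
        nz1[of "g x y * inverse c"] nz1[of "lin k x y * inverse l0"] unfolding R3_def by auto
    have "of_real (m k) * (g' x y - 1) = of_real (m k) * (P k x0 y0 t0 - 1) +
        (Ln (g x y * inverse c) - Ln (lin k x y * inverse l0))"
      using mk by (simp add: g'_def field_simps)
    then have "exp (of_real (m k) * (g' x y - 1)) = exp (of_real (m k) * (P k x0 y0 t0 - 1)) *
        (g x y * inverse c) / (lin k x y * inverse l0)"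
      using 1 by (simp add: exp_add exp_diff)
    moreover have "c = l0 * exp (of_real (m k) * (P k x0 y0 t0 - 1))" by (simp add: c_def l0_def)
    ultimately have "lin k x y * exp (of_real (m k) * (g' x y - 1)) = g x y"
      using nz 1 by (simp add: field_simps)
    moreover have "P k x y (T x y) = g' x y" using xy by (intro T) (auto simp: R3_def)
    ultimately show ?thesis by simp
  qed
  moreover have "sep_holomorphic_on T (ball x0 R3) (ball y0 R3)"
    by (rule sep_holomorphic_on_subset[OF T(2)]) (auto simp: R3_def)
  ultimately show ?case using T(1,3) R2(1) by (intro exI[of _ R3]) (auto simp: R3_def)
qed

text \<open>In the unit ball \<open>P k = 1\<close> keeps every earlier \<open>P j\<close> away from
  0, so the level set of \<open>P k\<close> is locally a graph \<open>t = T x y\<close>. On it the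
  condition on \<open>q\<close> becomes one equation in two variables, to which
  \<open>common_zero_Re_nonneg\<close> applies.\<close>

lemma no_strict_max_on_level_set:
  assumes q: "entire3 q"
  shows "no_strict_max_on (ball 0 1) {z. P k (fst z) (fst (snd z)) (snd (snd z)) = 1 \<and> q z = q 0}"
    (is "no_strict_max_on _ ?Z")
  unfolding no_strict_max_on_def
proof (intro ballI allI impI)
  fix z b :: "complex \<times> complex \<times> complex" and r :: real
  assume z: "z \<in> ?Z \<inter> ball 0 1" and r: "r > 0"
  obtain x0 y0 t0 where z_eq: "z = (x0, y0, t0)" by (cases z)
  obtain b1 b2 b3 where b_eq: "b = (b1, b2, b3)" by (cases b)
  have "norm x0 \<le> 1" "norm y0 \<le> 1"
    using z norm_fst_le[of x0 "(y0, t0)"] norm_snd_le[of "(y0, t0)" x0] norm_fst_le[of y0 t0]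
    by (auto simp: z_eq)
  then have "1/2 \<le> Re (P j x0 y0 t0)" if "j \<le> k" for j
    by (rule Re_P_ge[OF _ _ _ that]) (use z in \<open>auto simp: z_eq\<close>)
  then have nz: "P j x0 y0 t0 \<noteq> 0" if "j \<le> k" for j using that by force
  obtain R T where T: "R > 0" "sep_holomorphic_on T (ball x0 R) (ball y0 R)" "T x0 y0 = t0"
      "\<And>x y. x \<in> ball x0 R \<Longrightarrow> y \<in> ball y0 R \<Longrightarrow> P k x y (T x y) = 1"
    using local_graph[OF nz sep_holomorphic_on_const[of 1], of k 1] z by (auto simp: z_eq)
  have Tc: "continuous_on (ball x0 R \<times> ball y0 R) (\<lambda>w. T (fst w) (snd w))"
    using T(2) by (simp add: sep_holomorphic_on_def split_beta)
  obtain R' where R': "0 < R'" "R' \<le> R" "\<And>x y. x \<in> ball x0 R' \<Longrightarrow> y \<in> ball y0 R' \<Longrightarrow>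
      (\<lambda>w. (fst w, snd w, T (fst w) (snd w))) (x, y) \<in> ball z r"
    by (rule continuous_on_box_nhd[of x0 R y0 "\<lambda>w. (fst w, snd w, T (fst w) (snd w))" "ball z r"])
       (use Tc T r in \<open>auto simp: z_eq intro!: continuous_intros\<close>)
  have T': "sep_holomorphic_on T (ball x0 R') (ball y0 R')"
    by (rule sep_holomorphic_on_subset[OF T(2)]) (use R' in auto)
  have "sep_holomorphic_on (\<lambda>x y. q (x, y, T x y)) (ball x0 R') (ball y0 R')"
  proof -
    have "continuous_on (ball x0 R' \<times> ball y0 R') (\<lambda>w. q (fst w, snd w, T (fst w) (snd w)))"
    proof (rule continuous_on_compose2[of UNIV q])
      show "continuous_on (ball x0 R' \<times> ball y0 R') (\<lambda>w. (fst w, snd w, T (fst w) (snd w)))"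
        using T' by (auto simp: sep_holomorphic_on_def split_beta intro!: continuous_intros)
    qed (use q in \<open>auto simp: entire3_def\<close>)
    moreover have "(\<lambda>x. q (x, y, T x y)) holomorphic_on ball x0 R'" if "y \<in> ball y0 R'" for y
    proof -
      have "(\<lambda>x. T x y) holomorphic_on ball x0 R'" using T' that by (auto simp: sep_holomorphic_on_def)
      moreover have "(\<lambda>x. x) holomorphic_on ball x0 R'" "(\<lambda>x. y) holomorphic_on ball x0 R'"
        by (auto intro: holomorphic_intros)
      ultimately show ?thesis using q open_ball unfolding entire3_def by blast
    qed
    moreover have "(\<lambda>y. q (x, y, T x y)) holomorphic_on ball y0 R'" if "x \<in> ball x0 R'" for x
    proof -
      have "T x holomorphic_on ball y0 R'" using T' that by (auto simp: sep_holomorphic_on_def)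
      moreover have "(\<lambda>y. x) holomorphic_on ball y0 R'" "(\<lambda>y. y) holomorphic_on ball y0 R'"
        by (auto intro: holomorphic_intros)
      ultimately show ?thesis using q open_ball unfolding entire3_def by blast
    qed
    ultimately show ?thesis by (simp add: sep_holomorphic_on_def split_beta)
  qed
  then have qT: "sep_holomorphic_on (\<lambda>x y. q (x, y, T x y) - q 0) (ball x0 R') (ball y0 R')"
    by (intro sep_holomorphic_intros)
  \<comment> \<open>\<open>Re (H x y)\<close> is the real inner product of \<open>b\<close> with the
    displacement from \<open>z\<close>, since each component contributes
    \<open>Re (cnj b1 * u)\<close> for its displacement \<open>u\<close>.\<close>
  define H where "H = (\<lambda>x y. cnj b1 * (x - x0) + (cnj b2 * (y - y0) + cnj b3 * (T x y - t0)))"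
  have Hh: "sep_holomorphic_on H (ball x0 R') (ball y0 R')"
    unfolding H_def by (intro sep_holomorphic_intros T')
  obtain x y where xy: "x \<in> ball x0 R'" "y \<in> ball y0 R'" "(x, y) \<noteq> (x0, y0)"
      "q (x, y, T x y) = q 0" "0 \<le> Re (H x y)"
    using common_zero_Re_nonneg[OF qT Hh R'(1)] T(3) z by (auto simp: z_eq H_def)
  have "((x, y, T x y) - z) \<bullet> b = Re (H x y)"
    by (simp add: z_eq b_eq H_def inner_complex_def algebra_simps)
  moreover have "(x, y, T x y) \<in> ?Z" using xy R' T(4)[of x y] by auto
  moreover have "dist (x, y, T x y) z < r" using R'(3)[OF xy(1,2)] by (simp add: dist_commute)
  ultimately show "\<exists>w\<in>?Z. w \<noteq> z \<and> dist w z < r \<and> 0 \<le> (w - z) \<bullet> b"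
    using xy by (intro bexI[of _ "(x, y, T x y)"]) (auto simp: z_eq)
qed

text \<open>A nonconstant \<open>h1\<close> or \<open>h2\<close> would be an open map and hit some
  \<open>a k\<close>, where \<open>P (Suc k)\<close> vanishes. With both constant, differentiating
  the recursion multiplies the derivative by \<open>m k * g (Suc k) w\<close>, of modulus at least
  2, whereas the half-plane estimate bounds all derivatives at once.\<close>

lemma holomorphic_discs_constant:
  assumes h: "h1 holomorphic_on ball 0 1" "h2 holomorphic_on ball 0 1" "h3 holomorphic_on ball 0 1"
    and ge: "\<And>k w. w \<in> ball 0 1 \<Longrightarrow> 1/2 \<le> Re (P k (h1 w) (h2 w) (h3 w))"
    and dense: "\<And>U b. open U \<Longrightarrow> U \<noteq> {} \<Longrightarrow> \<exists>k. first k = b \<and> a k \<in> U"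
  shows "h1 constant_on ball 0 1" "h2 constant_on ball 0 1" "h3 constant_on ball 0 1"
proof -
  have nzP: "P k (h1 w) (h2 w) (h3 w) \<noteq> 0" if "w \<in> ball 0 1" for k w
    using ge[OF that, of k] by force
  have lin_nz: "lin k (h1 w) (h2 w) \<noteq> 0" if "w \<in> ball 0 1" for k w
    using nzP[OF that, of "Suc k"] by auto
  show 1: "h1 constant_on ball 0 1"
  proof (rule ccontr)
    assume "\<not> ?thesis"
    then have "open (h1 ` ball 0 1)" by (intro open_mapping_thm[OF h(1)]) auto
    moreover have "h1 ` ball 0 1 \<noteq> {}" by simp
    ultimately obtain k where "first k = True" "a k \<in> h1 ` ball 0 1" using dense by blast
    then obtain w where "w \<in> ball 0 1" "h1 w = a k" "first k = True" by auto
    then show False using lin_nz[of w k] a_nz[of k] by (simp add: lin_def)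
  qed
  show 2: "h2 constant_on ball 0 1"
  proof (rule ccontr)
    assume "\<not> ?thesis"
    then have "open (h2 ` ball 0 1)" by (intro open_mapping_thm[OF h(2)]) auto
    moreover have "h2 ` ball 0 1 \<noteq> {}" by simp
    ultimately obtain k where "first k = False" "a k \<in> h2 ` ball 0 1" using dense by blast
    then obtain w where "w \<in> ball 0 1" "h2 w = a k" "first k = False" by auto
    then show False using lin_nz[of w k] a_nz[of k] by (simp add: lin_def)
  qed
  obtain x y where xy: "\<And>w. w \<in> ball 0 1 \<Longrightarrow> h1 w = x" "\<And>w. w \<in> ball 0 1 \<Longrightarrow> h2 w = y"
    using 1 2 unfolding constant_on_def by metis
  define g where "g = (\<lambda>k w. P k x y (h3 w))"
  have gRe: "1/2 \<le> Re (g k w)" if "w \<in> ball 0 1" for k w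
    using ge[OF that, of k] xy[OF that] by (simp add: g_def)
  have ghol: "g k holomorphic_on ball 0 1" for k
  proof (induction k)
    case 0
    then show ?case using h(3) by (auto simp: g_def intro!: holomorphic_intros)
  next
    case (Suc k)
    have "(\<lambda>w. lin k x y * exp (of_real (m k) * (g k w - 1))) holomorphic_on ball 0 1"
      by (intro holomorphic_intros Suc)
    then show ?case by (simp add: g_def)
  qed
  have der: "(g k has_field_derivative deriv (g k) w) (at w)" if "w \<in> ball 0 1" for k w
    using holomorphic_derivI[OF ghol open_ball that] by simp
  have derS: "deriv (g (Suc k)) w = of_real (m k) * g (Suc k) w * deriv (g k) w" if "w \<in> ball 0 1" for k w
  proof -
    have "((\<lambda>w. lin k x y * exp (of_real (m k) * (g k w - 1))) has_field_derivative
        of_real (m k) * g (Suc k) w * deriv (g k) w) (at w)"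
      by (rule derivative_eq_intros der[OF that] refl)+ (simp add: g_def)
    then show ?thesis by (intro DERIV_imp_deriv) (simp add: g_def)
  qed
  have zero: "deriv h3 w = 0" if w: "w \<in> ball 0 1" for w
  proof (rule ccontr)
    assume nz: "deriv h3 w \<noteq> 0"
    have low: "2 ^ k * norm (deriv h3 w) \<le> norm (deriv (g k) w)" for k
    proof (induction k)
      case 0
      have "deriv (g 0) w = deriv h3 w"
        using holomorphic_derivI[OF h(3) open_ball w]
        by (intro DERIV_imp_deriv) (auto simp: g_def intro!: derivative_eq_intros)
      then show ?case by simp
    next
      case (Suc k)
      have "1/2 \<le> norm (g (Suc k) w)"
        using gRe[OF w, of "Suc k"] complex_Re_le_cmod[of "g (Suc k) w"] by linarith
      then have "4 * (1/2) \<le> m k * norm (g (Suc k) w)"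
        using m_ge[of k] by (intro mult_mono) auto
      then have "2 * norm (deriv (g k) w) \<le> norm (deriv (g (Suc k)) w)"
        unfolding derS[OF w] using m_ge[of k] by (simp add: norm_mult mult_right_mono)
      then show ?case using Suc by simp
    qed
    obtain r where r: "r > 0" "cball w r \<subseteq> ball 0 1" using w open_contains_cball open_ball by metis
    \<comment> \<open>The estimate for \<open>g (Suc k)\<close> is divided by
      \<open>norm (g (Suc k) w)\<close>; by \<open>derS\<close> this leaves
      \<open>m k * norm (deriv (g k) w)\<close>, with a bound independent of
      \<open>k\<close>.\<close>
    have up: "norm (deriv (g k) w) \<le> exp pi / r" for k
    proof -
      have "norm (deriv (g (Suc k)) w) \<le> exp pi / r * norm (g (Suc k) w)"
      proof (rule halfplane_deriv_bound[OF _ r(1)])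
        show "g (Suc k) holomorphic_on cball w r" using ghol r(2) holomorphic_on_subset by blast
        show "0 < Re (g (Suc k) z)" if "z \<in> cball w r" for z
          using gRe[of z "Suc k"] that r(2) by force
      qed
      moreover have "norm (g (Suc k) w) > 0" using gRe[OF w, of "Suc k"] by force
      moreover have "norm (deriv (g (Suc k)) w) = m k * norm (deriv (g k) w) * norm (g (Suc k) w)"
        unfolding derS[OF w] using m_ge[of k] by (simp add: norm_mult)
      ultimately have "m k * norm (deriv (g k) w) \<le> exp pi / r"
        by (metis mult_le_cancel_right_pos)
      moreover have "1 * norm (deriv (g k) w) \<le> m k * norm (deriv (g k) w)"
        using m_ge[of k] by (intro mult_right_mono) auto
      ultimately show ?thesis by simp
    qed
    obtain k where "exp pi / r / norm (deriv h3 w) < 2 ^ k"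
      using real_arch_pow[of 2 "exp pi / r / norm (deriv h3 w)"] by auto
    then have "exp pi / r < 2 ^ k * norm (deriv h3 w)" using nz by (subst (asm) divide_less_eq) auto
    then show False using low[of k] up[of k] by linarith
  qed
  show "h3 constant_on ball 0 1"
  proof -
    have "\<exists>c. \<forall>w\<in>ball 0 1. h3 w = c"
      using has_field_derivative_zero_constant[of "ball 0 1" h3] zero holomorphic_derivI[OF h(3) open_ball]
      by (metis convex_ball has_field_derivative_at_within)
    then show ?thesis by (auto simp: constant_on_def)
  qed
qed

end

section \<open>The totally disconnected compact set with a nontrivial hull\<close>

context tower
begin

text \<open>The last property is what will put \<open>0\<close> into a hull although
  \<open>0 \<notin> E\<close>. It follows by compactness, because each set \<open>P k = 1\<close>,
  \<open>q = q 0\<close> contains \<open>0\<close> and hence meets \<open>X0\<close>.\<close>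

lemma totally_disconnected_tower_set:
  obtains E :: "(complex \<times> complex \<times> complex) set" and B :: "nat \<Rightarrow> (complex \<times> complex \<times> complex) set"
  where "compact E" "0 \<notin> E" "\<And>i. open (B i)" "\<And>i. closed (E \<inter> B i)"
    "\<And>x y. x \<in> E \<Longrightarrow> y \<in> E \<Longrightarrow> x \<noteq> y \<Longrightarrow> \<exists>i. x \<in> B i \<and> y \<notin> B i"
    "\<And>z k. z \<in> E \<Longrightarrow> 1/2 \<le> Re (P k (fst z) (fst (snd z)) (snd (snd z)))"
    "\<And>q. entire3 q \<Longrightarrow> \<exists>z\<in>E. q z = q 0"
proof -
  obtain X0 :: "(complex \<times> complex \<times> complex) set"
      and B :: "nat \<Rightarrow> (complex \<times> complex \<times> complex) set" where X0: "compact X0" "X0 \<subseteq> cball 0 1" "0 \<notin> X0"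
    and B: "\<And>i. open (B i)" "\<And>i. closed (X0 \<inter> B i)"
      "\<And>x y. x \<in> X0 \<Longrightarrow> y \<in> X0 \<Longrightarrow> x \<noteq> y \<Longrightarrow> \<exists>i. x \<in> B i \<and> y \<notin> B i"
    and meets: "\<And>Z. closed Z \<Longrightarrow> no_strict_max_on (ball 0 1) Z \<Longrightarrow> 0 \<in> Z \<Longrightarrow> Z \<inter> X0 \<noteq> {}"
    by (rule totally_disconnected_barrier) (rule that)
  let ?P = "\<lambda>k z. P k (fst z) (fst (snd z)) (snd (snd z))"
  define E where "E = X0 \<inter> {z. \<forall>k. 1/2 \<le> Re (?P k z)}"
  have Pc: "continuous_on UNIV (\<lambda>z. Re (?P k z))" for k
    using continuous_on_P by (rule continuous_on_Re)
  have cl: "closed {z. \<forall>k. 1/2 \<le> Re (?P k z)}"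
    by (intro closed_Collect_all closed_Collect_le continuous_on_const Pc)
  have "\<exists>z\<in>E. q z = q 0" if q: "entire3 q" for q
  proof -
    have qc: "continuous_on UNIV q" using q by (simp add: entire3_def)
    \<comment> \<open>Only the conditions for \<open>j \<le> k\<close> are imposed, which makes the
      sets nested; a point of \<open>X0\<close> with \<open>P k = 1\<close> satisfies all of them by
      \<open>Re_P_ge\<close>.\<close>
    define F where "F = (\<lambda>k. X0 \<inter> {z. q z = q 0 \<and> (\<forall>j\<le>k. 1/2 \<le> Re (?P j z))})"
    have "\<Inter> (range F) \<noteq> {}"
    proof (rule compact_nest)
      show "compact (F k)" for k
      proof -
        have "F k = X0 \<inter> ({z. q z = q 0} \<inter> (\<Inter>j\<in>{..k}. {z. 1/2 \<le> Re (?P j z)}))"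
          by (auto simp: F_def)
        moreover have "closed {z. q z = q 0}" by (intro closed_Collect_eq qc continuous_on_const)
        moreover have "closed (\<Inter>j\<in>{..k}. {z. 1/2 \<le> Re (?P j z)})"
          by (intro closed_INT ballI closed_Collect_le continuous_on_const Pc)
        ultimately show ?thesis by (simp only: compact_Int_closed[OF X0(1)] closed_Int)
      qed
      show "F k \<noteq> {}" for k
      proof -
        let ?Z = "{z. ?P k z = 1 \<and> q z = q 0}"
        have "closed ?Z"
          by (intro closed_Collect_conj closed_Collect_eq continuous_on_const continuous_on_P qc)
        moreover have "0 \<in> ?Z" by (simp add: P_0)
        ultimately obtain z where z: "?P k z = 1" "q z = q 0" "z \<in> X0"
          using meets[OF _ no_strict_max_on_level_set[OF q, of k]] by blast
        obtain x y t where z_eq: "z = (x, y, t)" by (cases z)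
        have "norm x \<le> 1" "norm y \<le> 1"
          using z(3) X0(2) norm_fst_le[of x "(y, t)"] norm_snd_le[of "(y, t)" x] norm_fst_le[of y t]
          by (auto simp: z_eq)
        then have "1/2 \<le> Re (P j x y t)" if "j \<le> k" for j
          by (rule Re_P_ge[OF _ _ _ that]) (use z in \<open>auto simp: z_eq\<close>)
        then have "z \<in> F k" using z by (auto simp: F_def z_eq)
        then show ?thesis by blast
      qed
      show "F n \<subseteq> F k" if "k \<le> n" for k n using that by (auto simp: F_def)
    qed
    then obtain z where "\<And>k. z \<in> F k" by blast
    then have "z \<in> E" "q z = q 0" by (auto simp: E_def F_def)
    then show ?thesis by blast
  qed
  note 7 = this
  have 1: "compact E" unfolding E_def by (rule compact_Int_closed[OF X0(1) cl])
  have 4: "closed (E \<inter> B i)" for i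
  proof -
    have "E \<inter> B i = (X0 \<inter> B i) \<inter> {z. \<forall>k. 1/2 \<le> Re (?P k z)}" by (auto simp: E_def)
    then show ?thesis by (simp only: closed_Int[OF B(2) cl])
  qed
  have sub: "E \<subseteq> X0" by (auto simp: E_def)
  show ?thesis
  proof (rule that[OF 1 _ B(1) 4 _ _ 7])
    show "0 \<notin> E" using X0(3) sub by blast
    show "\<exists>i. x \<in> B i \<and> y \<notin> B i" if "x \<in> E" "y \<in> E" "x \<noteq> y" for x y
      using that sub by (intro B(3)) auto
    show "1/2 \<le> Re (?P k z)" if "z \<in> E" for z k using that by (simp add: E_def)
  qed
qed

end

text \<open>Pairing a countable dense set with \<open>bool\<close> makes each of its values occur
  for both coordinates; \<open>0\<close> is dropped because the tower divides by
  \<open>a k\<close>.\<close>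

lemma exists_dense_tower:
  obtains a :: "nat \<Rightarrow> complex" and first :: "nat \<Rightarrow> bool"
  where "tower a" "\<And>U b. open U \<Longrightarrow> U \<noteq> {} \<Longrightarrow> \<exists>k. first k = b \<and> a k \<in> U"
proof -
  obtain D :: "complex set" where D: "countable D" "\<And>X. open X \<Longrightarrow> X \<noteq> {} \<Longrightarrow> \<exists>d\<in>D. d \<in> X"
    by (rule countable_dense_setE) blast
  define S where "S = (D - {0}) \<times> (UNIV :: bool set)"
  have dense: "\<exists>d\<in>D - {0}. d \<in> U" if "open U" "U \<noteq> {}" for U
  proof -
    have "U - {0} \<noteq> {}" using that not_open_singleton[of "0::complex"] by (auto dest: subset_singletonD)
    moreover have "open (U - {0})" using that by (simp add: open_delete)
    ultimately show ?thesis using D(2)[of "U - {0}"] by blast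
  qed
  have S: "S \<noteq> {}" "countable S" using D(1) dense[of UNIV] by (auto simp: S_def)
  define f where "f = from_nat_into S"
  have f: "range f = S" unfolding f_def using S by (rule range_from_nat_into)
  have "tower (\<lambda>k. fst (f k))"
  proof
    show "fst (f k) \<noteq> 0" for k
      using rangeI[of f k] unfolding f S_def by (auto simp: mem_Times_iff)
  qed
  moreover have "\<exists>k. snd (f k) = b \<and> fst (f k) \<in> U" if U: "open U" "U \<noteq> {}" for U b
  proof -
    obtain d where d: "d \<in> D - {0}" "d \<in> U" using dense U by blast
    then have "(d, b) \<in> range f" using f by (simp add: S_def)
    then obtain k where "f k = (d, b)" by (metis imageE)
    then show ?thesis using d by (intro exI[of _ k]) simp
  qed
  ultimately show ?thesis by (rule that)
qed

section \<open>Embedding into uncountable compact sets\<close>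

text \<open>By Lindelof's theorem only countably many points of \<open>A\<close> have a ball that
  meets \<open>A\<close> in a countable set. Small disjoint closed balls about two of the remaining
  points cut out the pieces.\<close>

lemma uncountable_two_small_pieces:
  fixes A :: "'a::euclidean_space set"
  assumes A: "compact A" "uncountable A" and e: "e > 0"
  shows "\<exists>A0 A1. compact A0 \<and> compact A1 \<and> uncountable A0 \<and> uncountable A1 \<and> A0 \<subseteq> A \<and> A1 \<subseteq> A \<and>
     A0 \<inter> A1 = {} \<and> (\<forall>x\<in>A0. \<forall>y\<in>A0. dist x y \<le> e) \<and> (\<forall>x\<in>A1. \<forall>y\<in>A1. dist x y \<le> e)"
proof -
  define \<F> where "\<F> = {b. \<exists>x r. b = ball x r \<and> countable (A \<inter> b)}"
  have "open S" if "S \<in> \<F>" for S using that by (auto simp: \<F>_def)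
  then obtain \<F>' where F': "\<F>' \<subseteq> \<F>" "countable \<F>'" "\<Union>\<F>' = \<Union>\<F>"
    using Lindelof[of \<F>] by blast
  have "A \<inter> \<Union>\<F> = (\<Union>b\<in>\<F>'. A \<inter> b)" using F' by blast
  moreover have "countable (\<Union>b\<in>\<F>'. A \<inter> b)"
  proof (rule countable_UN[OF F'(2)])
    show "countable (A \<inter> b)" if "b \<in> \<F>'" for b using that F'(1) unfolding \<F>_def by blast
  qed
  ultimately have "countable (A \<inter> \<Union>\<F>)" by simp
  then have unc: "uncountable (A - A \<inter> \<Union>\<F>)" using A(2) by (rule uncountable_minus_countable[rotated])
  then have "infinite (A - A \<inter> \<Union>\<F>)" by (rule uncountable_infinite)
  then have "A - A \<inter> \<Union>\<F> \<noteq> {}" by (metis finite.emptyI)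
  then obtain x where x: "x \<in> A - A \<inter> \<Union>\<F>" by blast
  have "infinite (A - A \<inter> \<Union>\<F> - {x})" using \<open>infinite (A - A \<inter> \<Union>\<F>)\<close> by simp
  then have "A - A \<inter> \<Union>\<F> - {x} \<noteq> {}" by (metis finite.emptyI)
  then obtain y where y: "y \<in> A - A \<inter> \<Union>\<F>" "y \<noteq> x" by blast
  have big: "uncountable (A \<inter> cball z r)" if "z \<in> A - A \<inter> \<Union>\<F>" "r > 0" for z r
  proof
    assume "countable (A \<inter> cball z r)"
    then have "countable (A \<inter> ball z r)" by (rule countable_subset[rotated]) auto
    then have "ball z r \<in> \<F>" by (auto simp: \<F>_def)
    then show False using that by auto
  qed
  define r where "r = min (e / 2) (dist x y / 3)"
  have r: "r > 0" "2 * r \<le> e" "3 * r \<le> dist x y" using e y by (auto simp: r_def)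
  have small: "dist u v \<le> e" if "u \<in> A \<inter> cball z r" "v \<in> A \<inter> cball z r" for u v z
    using that dist_triangle[of u v z] r by (auto simp: dist_commute)
  have "(A \<inter> cball x r) \<inter> (A \<inter> cball y r) = {}"
  proof (rule ccontr)
    assume "\<not> ?thesis"
    then obtain u where "dist x u \<le> r" "dist y u \<le> r" by auto
    then show False using r dist_triangle[of x y u] by (simp add: dist_commute)
  qed
  moreover have "\<forall>u\<in>A \<inter> cball z r. \<forall>v\<in>A \<inter> cball z r. dist u v \<le> e" for z
    by (intro ballI small)
  moreover have "compact (A \<inter> cball z r)" for z using A(1) by (rule compact_Int) simp
  ultimately show ?thesis
    using big[OF x r(1)] big[OF y(1) r(1)]
    by (intro exI[of _ "A \<inter> cball x r"] exI[of _ "A \<inter> cball y r"] conjI Int_lower1)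
qed

text \<open>A Cantor scheme: \<open>K\<close> is split again and again into disjoint uncountable
  compact pieces with diameters tending to 0, and a point of \<open>E\<close> follows the branch
  spelled by its memberships in the sets \<open>B i\<close>.\<close>

lemma uncountable_compact_embeds_clopen_separated:
  fixes K :: "'a::euclidean_space set" and E :: "'b::metric_space set"
  assumes K: "compact K" "uncountable K"
    and B: "\<And>i. open (B i)" "\<And>i. closed (E \<inter> B i)"
      "\<And>x y. x \<in> E \<Longrightarrow> y \<in> E \<Longrightarrow> x \<noteq> y \<Longrightarrow> \<exists>i::nat. x \<in> B i \<and> y \<notin> B i"
  obtains g where "continuous_on E g" "inj_on g E" "g ` E \<subseteq> K"
proof -
  define Q where "Q = (\<lambda>n (A :: 'a set) h. \<forall>b. compact (h b) \<and> uncountable (h b) \<and> h b \<subseteq> A \<and>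
      h True \<inter> h False = {} \<and> (\<forall>x\<in>h b. \<forall>y\<in>h b. dist x y \<le> inverse (Suc n)))"
  define h where "h = (\<lambda>n A. SOME h. Q n A h)"
  have Qh: "Q n A (h n A)" if A: "compact A" "uncountable A" for A :: "'a set" and n :: nat
  proof -
    have pos: "inverse (real (Suc n)) > 0" by simp
    obtain A0 A1 where "compact A0" "compact A1" "uncountable A0" "uncountable A1" "A0 \<subseteq> A" "A1 \<subseteq> A"
       "A0 \<inter> A1 = {}" "\<forall>x\<in>A0. \<forall>y\<in>A0. dist x y \<le> inverse (Suc n)" "\<forall>x\<in>A1. \<forall>y\<in>A1. dist x y \<le> inverse (Suc n)"
      using uncountable_two_small_pieces[OF A pos] by (elim exE conjE)
    then have "Q n A (\<lambda>b. if b then A0 else A1)" by (simp add: Q_def)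
    then show ?thesis unfolding h_def by (rule someI[of "Q n A"])
  qed
  have h: "compact (h n A b)" "uncountable (h n A b)" "h n A b \<subseteq> A" "h n A True \<inter> h n A False = {}"
      "\<And>x y. x \<in> h n A b \<Longrightarrow> y \<in> h n A b \<Longrightarrow> dist x y \<le> inverse (Suc n)"
    if A: "compact A" "uncountable A" for n b and A :: "'a set"
    using Qh[OF A, of n, unfolded Q_def, THEN spec, of b] by simp_all
  \<comment> \<open>The nodes along the branch \<open>s\<close>: step \<open>n\<close> takes the
    piece selected by \<open>s n\<close>, so \<open>U s n\<close> depends only on the first
    \<open>n\<close> values of \<open>s\<close>.\<close>
  define U where "U = (\<lambda>s::nat \<Rightarrow> bool. rec_nat K (\<lambda>n A. h n A (s n)))"
  have U_simps: "U s 0 = K" "U s (Suc n) = h n (U s n) (s n)" for s n by (auto simp: U_def)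
  have U: "compact (U s n) \<and> uncountable (U s n)" for s n
  proof (induction n)
    case (Suc n)
    then show ?case using h(1,2)[of "U s n" n "s n"] by (simp add: U_simps)
  qed (use K in \<open>simp add: U_simps\<close>)
  have U_mono: "U s n \<subseteq> U s k" if "k \<le> n" for s k n
  proof (rule lift_Suc_antimono_le[OF _ that])
    show "U s (Suc n) \<subseteq> U s n" for n
      using h(3)[of "U s n" n "s n"] U[of s n] by (simp add: U_simps)
  qed
  have U_cong: "U s n = U s' n" if "\<And>i. i < n \<Longrightarrow> s i = s' i" for s s' n
    using that by (induction n) (auto simp: U_simps)
  have "\<Inter> (range (U s)) \<noteq> {}" for s
  proof (rule compact_nest)
    show "compact (U s n)" for n using U[of s n] by simp
    show "U s n \<noteq> {}" for n using U[of s n] by auto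
    show "U s n \<subseteq> U s k" if "k \<le> n" for k n by (rule U_mono[OF that])
  qed
  then have "\<forall>s. \<exists>v. v \<in> \<Inter> (range (U s))" by blast
  then obtain c where "\<forall>s. c s \<in> \<Inter> (range (U s))" by (rule choice[THEN exE])
  then have c: "c s \<in> U s n" for s n by blast
  define code where "code = (\<lambda>x i. x \<in> B i)"
  define g where "g = (\<lambda>x. c (code x))"
  have "continuous_on E g"
    unfolding continuous_on_def
  proof (intro ballI tendstoI)
    fix x and \<epsilon> :: real assume x: "x \<in> E" and \<epsilon>: "\<epsilon> > 0"
    obtain n where n: "inverse (Suc n) < \<epsilon>" using reals_Archimedean[OF \<epsilon>] by blast
    \<comment> \<open>Each bit of the code is locally constant on \<open>E\<close> because
      \<open>E \<inter> B i\<close> is clopen in \<open>E\<close>. Agreement of the first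
      \<open>Suc n\<close> bits confines both images to a piece of diameter at most
      \<open>inverse (Suc n)\<close>.\<close>
    have "eventually (\<lambda>y. code y i = code x i) (at x within E)" for i
    proof (cases "x \<in> B i")
      case True
      then have "eventually (\<lambda>y. y \<in> B i) (at x within E)"
        using B(1) eventually_at_topological by blast
      then show ?thesis by eventually_elim (use True in \<open>auto simp: code_def\<close>)
    next
      case False
      have "open (- (E \<inter> B i))" using B(2) by (rule open_Compl)
      then have "eventually (\<lambda>y. y \<notin> B i) (at x within E)"
        unfolding eventually_at_topological using False by blast
      then show ?thesis by eventually_elim (use False in \<open>auto simp: code_def\<close>)
    qed
    then have "eventually (\<lambda>y. \<forall>i\<in>{..<Suc n}. code y i = code x i) (at x within E)"
      by (intro eventually_ball_finite) auto
    then show "eventually (\<lambda>y. dist (g y) (g x) < \<epsilon>) (at x within E)"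
    proof eventually_elim
      case (elim y)
      then have "U (code y) (Suc n) = U (code x) (Suc n)" by (intro U_cong) auto
      then have "g y \<in> U (code x) (Suc n)" "g x \<in> U (code x) (Suc n)"
        using c unfolding g_def by metis+
      then have "dist (g y) (g x) \<le> inverse (Suc n)"
        using U[of "code x" n] unfolding U_simps by (intro h(5)[of "U (code x) n" _ n "code x n"]) auto
      then show ?case using n by simp
    qed
  qed
  \<comment> \<open>At the first bit where two codes differ, their branches enter disjoint pieces of
    the same set.\<close>
  moreover have "inj_on g E"
  proof (rule inj_onI, rule ccontr)
    fix x y assume xy: "x \<in> E" "y \<in> E" "g x = g y" "x \<noteq> y"
    then have "\<exists>i. code x i \<noteq> code y i" using B(3)[of x y] by (auto simp: code_def)
    then obtain i where i: "code x i \<noteq> code y i" "\<And>j. j < i \<Longrightarrow> code x j = code y j"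
      using exists_least_iff[of "\<lambda>i. code x i \<noteq> code y i"] by auto
    have "U (code x) i = U (code y) i" using i by (intro U_cong) auto
    moreover have "g x \<in> h i (U (code x) i) (code x i)" "g x \<in> h i (U (code y) i) (code y i)"
      using c[of "code x" "Suc i"] c[of "code y" "Suc i"] xy(3) by (auto simp: g_def U_simps)
    ultimately show False
      using h(4)[of "U (code x) i" i] U[of "code x" i] i(1) by (cases "code x i"; cases "code y i") auto
  qed
  moreover have "g ` E \<subseteq> K" using c[of _ 0] by (auto simp: g_def U_simps)
  ultimately show ?thesis by (rule that)
qed

section \<open>Polynomial hulls\<close>

lemma poly_funI:
  assumes "finite A" "\<And>z. p z = (\<Sum>\<alpha>\<in>A. c \<alpha> * (\<Prod>i\<in>UNIV. (z $ i) ^ (\<alpha> i)))"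
  shows "poly_fun p"
  unfolding poly_fun_def using assms by blast

lemma poly_fun_const: "poly_fun (\<lambda>_. c)"
  by (rule poly_funI[of "{\<lambda>_. 0}" _ "\<lambda>_. c"]) auto

lemma poly_fun_nth: "poly_fun (\<lambda>z. z $ j)"
proof (rule poly_funI[of "{\<lambda>i. if i = j then 1 else 0}" _ "\<lambda>_. 1"])
  fix z :: "complex ^ 'a"
  have "(\<Prod>i\<in>UNIV. (z $ i) ^ (if i = j then 1 else 0)) = (\<Prod>i\<in>UNIV. if i = j then z $ i else 1)"
    by (rule prod.cong) auto
  then show "z $ j = (\<Sum>\<alpha>\<in>{\<lambda>i. if i = j then 1 else 0}. 1 * (\<Prod>i\<in>UNIV. (z $ i) ^ (\<alpha> i)))" by simp
qed auto

lemma poly_fun_add: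
  assumes "poly_fun p" "poly_fun q"
  shows "poly_fun (\<lambda>z. p z + q z)"
proof -
  obtain A c where A: "finite A" "p = (\<lambda>z. \<Sum>\<alpha>\<in>A. c \<alpha> * (\<Prod>i\<in>UNIV. (z $ i) ^ (\<alpha> i)))"
    using assms(1) unfolding poly_fun_def by blast
  obtain B d where B: "finite B" "q = (\<lambda>z. \<Sum>\<alpha>\<in>B. d \<alpha> * (\<Prod>i\<in>UNIV. (z $ i) ^ (\<alpha> i)))"
    using assms(2) unfolding poly_fun_def by blast
  show ?thesis
  proof (rule poly_funI[of "A \<union> B" _ "\<lambda>\<alpha>. (if \<alpha> \<in> A then c \<alpha> else 0) + (if \<alpha> \<in> B then d \<alpha> else 0)"])
    fix z :: "complex ^ 'a"
    let ?m = "\<lambda>\<alpha>. \<Prod>i\<in>UNIV. (z $ i) ^ (\<alpha> i)"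
    have "p z = (\<Sum>\<alpha>\<in>A \<union> B. (if \<alpha> \<in> A then c \<alpha> else 0) * ?m \<alpha>)"
      unfolding A(2) using A(1) B(1) by (intro sum.mono_neutral_cong_left) auto
    moreover have "q z = (\<Sum>\<alpha>\<in>A \<union> B. (if \<alpha> \<in> B then d \<alpha> else 0) * ?m \<alpha>)"
      unfolding B(2) using A(1) B(1) by (intro sum.mono_neutral_cong_left) auto
    ultimately show "p z + q z = (\<Sum>\<alpha>\<in>A \<union> B. ((if \<alpha> \<in> A then c \<alpha> else 0) + (if \<alpha> \<in> B then d \<alpha> else 0)) * ?m \<alpha>)"
      by (simp only: sum.distrib[symmetric] distrib_right)
  qed (use A B in auto)
qed

lemma poly_fun_mult:
  assumes "poly_fun p" "poly_fun q"
  shows "poly_fun (\<lambda>z. p z * q z)"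
proof -
  obtain A c where A: "finite A" "p = (\<lambda>z. \<Sum>\<alpha>\<in>A. c \<alpha> * (\<Prod>i\<in>UNIV. (z $ i) ^ (\<alpha> i)))"
    using assms(1) unfolding poly_fun_def by blast
  obtain B d where B: "finite B" "q = (\<lambda>z. \<Sum>\<alpha>\<in>B. d \<alpha> * (\<Prod>i\<in>UNIV. (z $ i) ^ (\<alpha> i)))"
    using assms(2) unfolding poly_fun_def by blast
  let ?s = "\<lambda>(\<alpha>, \<beta>). (\<lambda>i. \<alpha> i + \<beta> i :: nat)"
  let ?k = "\<lambda>(\<alpha>, \<beta>). c \<alpha> * d \<beta>"
  \<comment> \<open>Different pairs of exponents may have the same sum, so coefficients are
    collected over the fibres of \<open>?s\<close>.\<close>
  show ?thesis
  proof (rule poly_funI[of "?s ` (A \<times> B)" _ "\<lambda>\<gamma>. \<Sum>x\<in>{x\<in>A \<times> B. ?s x = \<gamma>}. ?k x"])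
    fix z :: "complex ^ 'a"
    let ?m = "\<lambda>\<alpha>. \<Prod>i\<in>UNIV. (z $ i) ^ (\<alpha> i)"
    have "p z * q z = (\<Sum>x\<in>A \<times> B. ?k x * ?m (?s x))"
      unfolding A(2) B(2) sum_product sum.cartesian_product
      by (rule sum.cong) (auto simp: power_add prod.distrib algebra_simps)
    also have "\<dots> = (\<Sum>\<gamma>\<in>?s ` (A \<times> B). \<Sum>x\<in>{x\<in>A \<times> B. ?s x = \<gamma>}. ?k x * ?m (?s x))"
      using A(1) B(1) by (intro sum.image_gen) auto
    also have "\<dots> = (\<Sum>\<gamma>\<in>?s ` (A \<times> B). (\<Sum>x\<in>{x\<in>A \<times> B. ?s x = \<gamma>}. ?k x) * ?m \<gamma>)"
      unfolding sum_distrib_right by (intro sum.cong) auto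
    finally show "p z * q z = (\<Sum>\<gamma>\<in>?s ` (A \<times> B). (\<Sum>x\<in>{x\<in>A \<times> B. ?s x = \<gamma>}. ?k x) * ?m \<gamma>)" .
  qed (use A B in auto)
qed

lemma continuous_on_poly_fun: "poly_fun p \<Longrightarrow> continuous_on S p"
  unfolding poly_fun_def by (auto intro!: continuous_intros)

text \<open>For compact \<open>S\<close> these functions form an algebra closed under
  \<open>exp\<close>. It contains the tower functions, which are not polynomials, and hull
  inequalities extend to it.\<close>

definition unif_poly :: "(complex ^ 'n) set \<Rightarrow> (complex ^ 'n \<Rightarrow> complex) \<Rightarrow> bool" where
  "unif_poly S f \<longleftrightarrow> (\<forall>\<epsilon>>0. \<exists>p. poly_fun p \<and> (\<forall>z\<in>S. norm (f z - p z) < \<epsilon>))"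

lemma poly_fun_imp_unif_poly: "poly_fun p \<Longrightarrow> unif_poly S p"
  unfolding unif_poly_def by (intro allI impI exI[of _ p]) auto

lemma unif_poly_limit:
  assumes "\<And>\<epsilon>. \<epsilon> > 0 \<Longrightarrow> \<exists>g. unif_poly S g \<and> (\<forall>z\<in>S. norm (f z - g z) < \<epsilon>)"
  shows "unif_poly S f"
  unfolding unif_poly_def
proof (intro allI impI)
  fix \<epsilon> :: real assume "\<epsilon> > 0"
  then have e: "\<epsilon>/2 > 0" by simp
  obtain g where g: "unif_poly S g" "\<forall>z\<in>S. norm (f z - g z) < \<epsilon>/2" using assms[OF e] by blast
  obtain p where p: "poly_fun p" "\<forall>z\<in>S. norm (g z - p z) < \<epsilon>/2" using g(1) e unfolding unif_poly_def by blast
  have "norm (f z - p z) < \<epsilon>" if "z \<in> S" for z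
    using g(2) p(2) that norm_diff_triangle_less[of "f z" "g z" "\<epsilon>/2" "p z" "\<epsilon>/2"] by simp
  then show "\<exists>p. poly_fun p \<and> (\<forall>z\<in>S. norm (f z - p z) < \<epsilon>)" using p(1) by blast
qed

lemma unif_poly_add:
  assumes "unif_poly S f" "unif_poly S g"
  shows "unif_poly S (\<lambda>z. f z + g z)"
  unfolding unif_poly_def
proof (intro allI impI)
  fix \<epsilon> :: real assume "\<epsilon> > 0"
  then have e: "\<epsilon>/2 > 0" by simp
  obtain p where p: "poly_fun p" "\<forall>z\<in>S. norm (f z - p z) < \<epsilon>/2" using assms(1) e unfolding unif_poly_def by blast
  obtain q where q: "poly_fun q" "\<forall>z\<in>S. norm (g z - q z) < \<epsilon>/2" using assms(2) e unfolding unif_poly_def by blast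
  have "norm (f z + g z - (p z + q z)) < \<epsilon>" if "z \<in> S" for z
    using p(2) q(2) that norm_diff_triangle_ineq[of "f z" "g z" "p z" "q z"] by fastforce
  then show "\<exists>p. poly_fun p \<and> (\<forall>z\<in>S. norm (f z + g z - p z) < \<epsilon>)"
    using poly_fun_add[OF p(1) q(1)] by blast
qed

lemma unif_poly_bounded:
  assumes "unif_poly S f" "compact S"
  obtains M where "M > 0" "\<And>z. z \<in> S \<Longrightarrow> norm (f z) \<le> M"
proof -
  obtain p where p: "poly_fun p" "\<forall>z\<in>S. norm (f z - p z) < 1"
    using assms(1) unfolding unif_poly_def by (metis zero_less_one)
  have "bounded (p ` S)"
    using compact_continuous_image[OF continuous_on_poly_fun[OF p(1)] assms(2)] by (rule compact_imp_bounded)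
  then obtain M where M: "\<And>z. z \<in> S \<Longrightarrow> norm (p z) \<le> M" by (auto simp: bounded_iff)
  show ?thesis
  proof (rule that[of "\<bar>M\<bar> + 1"])
    fix z assume z: "z \<in> S"
    have "norm (f z) \<le> norm (p z) + norm (f z - p z)" by (rule norm_triangle_sub)
    then show "norm (f z) \<le> \<bar>M\<bar> + 1" using M[OF z] p(2) z by force
  qed auto
qed

lemma unif_poly_mult:
  assumes f: "unif_poly S f" and g: "unif_poly S g" and S: "compact S"
  shows "unif_poly S (\<lambda>z. f z * g z)"
  unfolding unif_poly_def
proof (intro allI impI)
  fix \<epsilon> :: real assume \<epsilon>: "\<epsilon> > 0"
  obtain M where M: "M > 0" "\<And>z. z \<in> S \<Longrightarrow> norm (f z) \<le> M" using unif_poly_bounded[OF f S] by blast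
  have e1: "\<epsilon> / (2 * M) > 0" using \<epsilon> M by simp
  obtain q where q: "poly_fun q" "\<forall>z\<in>S. norm (g z - q z) < \<epsilon> / (2 * M)" using g e1 unfolding unif_poly_def by blast
  obtain N where N: "N > 0" "\<And>z. z \<in> S \<Longrightarrow> norm (q z) \<le> N"
    using unif_poly_bounded[OF poly_fun_imp_unif_poly[OF q(1)] S] by blast
  have e2: "\<epsilon> / (2 * N) > 0" using \<epsilon> N by simp
  obtain p where p: "poly_fun p" "\<forall>z\<in>S. norm (f z - p z) < \<epsilon> / (2 * N)" using f e2 unfolding unif_poly_def by blast
  have "norm (f z * g z - p z * q z) < \<epsilon>" if z: "z \<in> S" for z
  proof -
    have "f z * g z - p z * q z = f z * (g z - q z) + (f z - p z) * q z" by (simp add: algebra_simps)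
    then have "norm (f z * g z - p z * q z) \<le> norm (f z) * norm (g z - q z) + norm (f z - p z) * norm (q z)"
      by (metis norm_mult norm_triangle_ineq)
    also have "\<dots> \<le> M * norm (g z - q z) + norm (f z - p z) * N"
      using M(2)[OF z] N(2)[OF z] M(1) by (intro add_mono mult_mono) auto
    also have "\<dots> < M * (\<epsilon> / (2 * M)) + (\<epsilon> / (2 * N)) * N"
      using M(1) N(1) p(2) q(2) z by (intro add_strict_mono mult_strict_left_mono mult_strict_right_mono) auto
    also have "\<dots> = \<epsilon>" using M N by simp
    finally show ?thesis .
  qed
  then show "\<exists>p. poly_fun p \<and> (\<forall>z\<in>S. norm (f z * g z - p z) < \<epsilon>)"
    using poly_fun_mult[OF p(1) q(1)] by blast
qed

lemma unif_poly_power: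
  assumes "unif_poly S f" "compact S"
  shows "unif_poly S (\<lambda>z. f z ^ n)"
  by (induction n) (auto intro: unif_poly_mult assms poly_fun_imp_unif_poly poly_fun_const)

lemma unif_poly_sum:
  assumes "\<And>i. i \<in> I \<Longrightarrow> unif_poly S (f i)"
  shows "unif_poly S (\<lambda>z. \<Sum>i\<in>I. f i z)"
  using assms
  by (induction I rule: infinite_finite_induct)
     (auto intro: unif_poly_add poly_fun_imp_unif_poly poly_fun_const)

text \<open>The range of \<open>f\<close> is bounded, and the Taylor polynomials of
  \<open>exp\<close> converge uniformly on bounded sets.\<close>

lemma unif_poly_exp:
  assumes f: "unif_poly S f" and S: "compact S"
  shows "unif_poly S (\<lambda>z. exp (f z))"
proof (rule unif_poly_limit)
  fix \<epsilon> :: real assume \<epsilon>: "\<epsilon> > 0"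
  obtain M where M: "M > 0" "\<And>z. z \<in> S \<Longrightarrow> norm (f z) \<le> M" using unif_poly_bounded[OF f S] by blast
  have "(\<lambda>n. M ^ n / fact n) \<longlonglongrightarrow> 0"
    using summable_LIMSEQ_zero[OF summable_exp[of M]] by (simp add: divide_inverse mult.commute)
  then have "(\<lambda>n. exp M * M * (M ^ n / fact n)) \<longlonglongrightarrow> exp M * M * 0" by (rule tendsto_mult_left)
  then have "eventually (\<lambda>n. exp M * M * (M ^ n / fact n) < \<epsilon>) sequentially"
    using \<epsilon> by (intro order_tendstoD(2)) auto
  then obtain n where n: "exp M * M * (M ^ n / fact n) < \<epsilon>"
    by (auto simp: eventually_sequentially)
  have "unif_poly S (\<lambda>z. \<Sum>i\<le>n. f z ^ i * inverse (fact i))"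
    by (intro unif_poly_sum unif_poly_mult unif_poly_power f S poly_fun_imp_unif_poly poly_fun_const)
  moreover have "norm (exp (f z) - (\<Sum>i\<le>n. f z ^ i * inverse (fact i))) < \<epsilon>" if z: "z \<in> S" for z
  proof -
    have "norm (exp (f z) - (\<Sum>i\<le>n. f z ^ i / fact i)) \<le> exp (norm (f z)) * (norm (f z) ^ Suc n) / fact n"
      by (rule Taylor_exp_field)
    also have "\<dots> \<le> exp M * M ^ Suc n / fact n"
      using M(1) M(2)[OF z] by (intro divide_right_mono mult_mono power_mono) auto
    also have "\<dots> < \<epsilon>" using n by (simp add: mult.assoc)
    finally show ?thesis by (simp add: divide_inverse)
  qed
  ultimately show "\<exists>g. unif_poly S g \<and> (\<forall>z\<in>S. norm (exp (f z) - g z) < \<epsilon>)" by blast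
qed

section \<open>Hulls and their fibres over real coordinates\<close>

lemma poly_hull_unif_poly_le:
  assumes z: "z \<in> poly_hull X" and X: "X \<noteq> {}" and f: "unif_poly (insert z X) f"
    and c: "\<And>x. x \<in> X \<Longrightarrow> norm (f x) \<le> c"
  shows "norm (f z) \<le> c"
proof (rule field_le_epsilon)
  fix \<epsilon> :: real assume "\<epsilon> > 0"
  then have "\<epsilon>/2 > 0" by simp
  \<comment> \<open>A single polynomial is close to \<open>f\<close> both on \<open>X\<close> and at
    \<open>z\<close>, so its hull inequality transfers to \<open>f\<close> up to the error.\<close>
  then obtain p where p: "poly_fun p" "\<forall>x\<in>insert z X. norm (f x - p x) < \<epsilon>/2"
    using f unfolding unif_poly_def by blast
  have "norm (p x) \<le> c + \<epsilon>/2" if "x \<in> X" for x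
    using c[OF that] p(2) that norm_triangle_sub[of "p x" "f x"] by (fastforce simp: norm_minus_commute)
  then have "(SUP x\<in>X. norm (p x)) \<le> c + \<epsilon>/2" using X by (intro cSUP_least) auto
  moreover have "norm (p z) \<le> (SUP x\<in>X. norm (p x))" using z p(1) by (auto simp: poly_hull_def)
  moreover have "norm (f z) \<le> norm (p z) + norm (f z - p z)" by (rule norm_triangle_sub)
  moreover have "norm (f z - p z) < \<epsilon>/2" using p(2) by simp
  ultimately show "norm (f z) \<le> c + \<epsilon>" by linarith
qed

text \<open>The polynomials \<open>w $ j - \<i> * t\<close> with real \<open>t\<close> are bounded
  by \<open>sqrt (M\<^sup>2 + t\<^sup>2)\<close> on \<open>X\<close>. At \<open>z\<close> this
  bounds \<open>- 2 * t * Im (z $ j)\<close> for all \<open>t\<close> of either sign, so the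
  imaginary part is 0.\<close>

lemma poly_hull_real_coordinate:
  assumes z: "z \<in> poly_hull X" and X: "compact X" "X \<noteq> {}" and real: "\<And>x. x \<in> X \<Longrightarrow> x $ j \<in> \<real>"
  shows "z $ j \<in> \<real>"
proof -
  obtain M where M: "M > 0" "\<And>x. x \<in> X \<Longrightarrow> norm (x $ j) \<le> M"
    using unif_poly_bounded[OF poly_fun_imp_unif_poly[OF poly_fun_nth] X(1)] by blast
  have ineq: "- 2 * t * Im (z $ j) \<le> M\<^sup>2" for t :: real
  proof -
    have "norm (z $ j + (- \<i> * t)) \<le> sqrt (M\<^sup>2 + t\<^sup>2)"
    proof (rule poly_hull_unif_poly_le[OF z X(2)])
      show "unif_poly (insert z X) (\<lambda>w. w $ j + (- \<i> * t))"
        by (intro unif_poly_add poly_fun_imp_unif_poly poly_fun_nth poly_fun_const)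
      fix x assume x: "x \<in> X"
      have "(Re (x $ j))\<^sup>2 \<le> M\<^sup>2"
        using M(2)[OF x] abs_Re_le_cmod[of "x $ j"] M(1) by (intro power2_le_iff_abs_le[THEN iffD2]) auto
      moreover have "Im (x $ j) = 0" using real[OF x] by (simp add: complex_is_Real_iff)
      ultimately show "norm (x $ j + (- \<i> * t)) \<le> sqrt (M\<^sup>2 + t\<^sup>2)" by (simp add: cmod_def)
    qed
    then have "(norm (z $ j + (- \<i> * t)))\<^sup>2 \<le> (sqrt (M\<^sup>2 + t\<^sup>2))\<^sup>2" by (intro power_mono) auto
    then have "(Re (z $ j))\<^sup>2 + (Im (z $ j) - t)\<^sup>2 \<le> M\<^sup>2 + t\<^sup>2" by (simp add: cmod_power2)
    moreover have "(Im (z $ j) - t)\<^sup>2 = (Im (z $ j))\<^sup>2 - 2 * t * Im (z $ j) + t\<^sup>2"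
      by (simp add: power2_diff)
    moreover have "(Re (z $ j))\<^sup>2 \<ge> 0" "(Im (z $ j))\<^sup>2 \<ge> 0" by auto
    ultimately show ?thesis by linarith
  qed
  have "Im (z $ j) = 0"
  proof (rule ccontr)
    assume nz: "Im (z $ j) \<noteq> 0"
    have "- 2 * (- (M\<^sup>2 + 1) / (2 * Im (z $ j))) * Im (z $ j) = M\<^sup>2 + 1" using nz by (simp add: field_simps)
    then show False using ineq[of "- (M\<^sup>2 + 1) / (2 * Im (z $ j))"] by linarith
  qed
  then show ?thesis by (simp add: complex_is_Real_iff)
qed

text \<open>Powers of the polynomial \<open>b\<close> in the proof peak on the fibre through \<open>z\<close>.\<close>

lemma poly_hull_fibre:
  fixes X :: "(complex ^ 'n) set"
  assumes z: "z \<in> poly_hull X" and X: "compact X" "X \<noteq> {}"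
    and real: "\<And>x j. x \<in> X \<Longrightarrow> j \<in> J \<Longrightarrow> x $ j \<in> \<real>"
    and f: "unif_poly (insert z X) f" "continuous_on X f"
    and c: "\<And>x. x \<in> X \<Longrightarrow> (\<And>j. j \<in> J \<Longrightarrow> x $ j = z $ j) \<Longrightarrow> norm (f x) \<le> c" and c0: "c \<ge> 0"
  shows "norm (f z) \<le> c"
proof (rule ccontr)
  assume "\<not> ?thesis"
  then obtain d where d: "c < d" "d < norm (f z)" using dense by (metis not_le)
  have zr: "z $ j \<in> \<real>" if "j \<in> J" for j
    by (rule poly_hull_real_coordinate[OF z X real[OF _ that]])
  define S where "S = (\<lambda>w::complex ^ 'n. \<Sum>j\<in>J. (Re (w $ j) - Re (z $ j))\<^sup>2)"
  have S0: "S w \<ge> 0" for w unfolding S_def by (intro sum_nonneg) auto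
  have Scont: "continuous_on X S" unfolding S_def by (intro continuous_intros)
  have finJ: "finite J" by simp
  obtain L where L: "L > 0" "\<And>x. x \<in> X \<Longrightarrow> S x \<le> L"
  proof -
    have "bounded (S ` X)" using compact_continuous_image[OF Scont X(1)] by (rule compact_imp_bounded)
    then obtain L where "\<And>x. x \<in> X \<Longrightarrow> norm (S x) \<le> L" by (auto simp: bounded_iff)
    then have "S x \<le> \<bar>L\<bar> + 1" if "x \<in> X" for x using that by fastforce
    then show thesis using that[of "\<bar>L\<bar> + 1"] by auto
  qed
  \<comment> \<open>On \<open>X\<close> this polynomial equals \<open>1 - S x / L\<close>: it takes
    values between 0 and 1, and the value 1 exactly on the fibre through \<open>z\<close>.\<close>
  define b where "b = (\<lambda>w::complex ^ 'n. 1 + (\<Sum>j\<in>J. (w $ j + - z $ j)\<^sup>2) * of_real (- inverse L))"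
  have bx: "b x = of_real (1 - S x / L)" if x: "x \<in> X" for x
  proof -
    have "(x $ j + - z $ j)\<^sup>2 = of_real ((Re (x $ j) - Re (z $ j))\<^sup>2)" if "j \<in> J" for j
    proof -
      have "x $ j = of_real (Re (x $ j))" "z $ j = of_real (Re (z $ j))"
        using real[OF x that] zr[OF that] by (auto simp: complex_is_Real_iff complex_eq_iff)
      then have "x $ j + - z $ j = of_real (Re (x $ j) - Re (z $ j))"
        by (metis add_uminus_conv_diff of_real_diff)
      then show ?thesis by simp
    qed
    then have "(\<Sum>j\<in>J. (x $ j + - z $ j)\<^sup>2) = of_real (S x)" by (simp add: S_def)
    then show ?thesis by (simp add: b_def divide_inverse)
  qed
  have bz: "b z = 1" by (simp add: b_def)
  have SC: "compact (insert z X)" using X(1) by simp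
  have bu: "unif_poly (insert z X) b"
    unfolding b_def
    by (intro unif_poly_add unif_poly_mult unif_poly_sum unif_poly_power SC poly_fun_imp_unif_poly poly_fun_const poly_fun_nth)
  have nb: "norm (b x) = 1 - S x / L" if "x \<in> X" for x
    using bx[OF that] L(1) L(2)[OF that] by (simp add: norm_of_real divide_le_eq del: of_real_diff)
  \<comment> \<open>\<open>Y\<close> is compact and misses the fibre, where
    \<open>norm (f x) \<le> c < d\<close>. Hence \<open>S\<close> has a positive minimum on
    \<open>Y\<close> if \<open>Y\<close> is nonempty, and \<open>b\<close> stays below some
    \<open>\<beta> < 1\<close> there.\<close>
  define Y where "Y = {x \<in> X. d \<le> norm (f x)}"
  have Ycomp: "compact Y"
  proof -
    have "closed (X \<inter> (\<lambda>x. norm (f x)) -` {d..})"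
      using X(1) f(2) by (intro continuous_closed_preimage continuous_intros compact_imp_closed) auto
    then have "compact (X \<inter> (X \<inter> (\<lambda>x. norm (f x)) -` {d..}))" by (rule compact_Int_closed[OF X(1)])
    moreover have "Y = X \<inter> (X \<inter> (\<lambda>x. norm (f x)) -` {d..})" by (auto simp: Y_def)
    ultimately show ?thesis by simp
  qed
  obtain M where M: "M > 0" "\<And>x. x \<in> insert z X \<Longrightarrow> norm (f x) \<le> M" using unif_poly_bounded[OF f(1) SC] by blast
  obtain \<beta> where \<beta>: "0 \<le> \<beta>" "\<beta> < 1" "\<And>x. x \<in> Y \<Longrightarrow> norm (b x) \<le> \<beta>"
  proof (cases "Y = {}")
    case True
    then show thesis using that[of 0] by auto
  next
    case False
    then obtain x0 where x0: "x0 \<in> Y" "\<forall>x\<in>Y. S x0 \<le> S x"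
      using continuous_attains_inf[OF Ycomp False] Scont continuous_on_subset[of X S Y] by (auto simp: Y_def)
    have "S x0 > 0"
    proof (rule ccontr)
      assume "\<not> S x0 > 0"
      then have "S x0 = 0" using S0[of x0] by simp
      then have "\<forall>j\<in>J. (Re (x0 $ j) - Re (z $ j))\<^sup>2 = 0"
        unfolding S_def using finJ by (subst (asm) sum_nonneg_eq_0_iff) auto
      then have "x0 $ j = z $ j" if "j \<in> J" for j
        using that real[of x0 j] zr[OF that] x0(1) by (auto simp: complex_eq_iff complex_is_Real_iff Y_def)
      then have "norm (f x0) \<le> c" using x0(1) by (intro c) (auto simp: Y_def)
      then show False using x0(1) d by (auto simp: Y_def)
    qed
    moreover have "norm (b x) \<le> 1 - S x0 / L" if "x \<in> Y" for x
      using nb[of x] x0(2) that L(1) by (auto simp: Y_def divide_right_mono)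
    moreover have "0 \<le> 1 - S x0 / L" using nb[of x0] x0(1) norm_ge_zero[of "b x0"] by (simp add: Y_def)
    ultimately show thesis using that[of "1 - S x0 / L"] L(1) by auto
  qed
  have "(\<lambda>N. M * \<beta> ^ N) \<longlonglongrightarrow> M * 0"
    using \<beta> by (intro tendsto_mult_left LIMSEQ_power_zero) auto
  then have "eventually (\<lambda>N. M * \<beta> ^ N < d) sequentially"
    by (rule order_tendstoD(2)) (use d c0 in auto)
  then obtain N where N: "M * \<beta> ^ N < d" by (auto simp: eventually_sequentially)
  \<comment> \<open>On \<open>Y\<close> the power of \<open>b\<close> beats the bound
    \<open>M\<close> of \<open>f\<close>; off \<open>Y\<close> already \<open>norm (f x) < d\<close>
    and \<open>norm (b x) \<le> 1\<close>. Since \<open>b z = 1\<close>, the left side is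
    \<open>norm (f z)\<close>.\<close>
  have "norm (f z * b z ^ N) \<le> d"
  proof (rule poly_hull_unif_poly_le[OF z X(2)])
    show "unif_poly (insert z X) (\<lambda>w. f w * b w ^ N)"
      by (intro unif_poly_mult unif_poly_power f(1) bu SC)
    fix x assume x: "x \<in> X"
    show "norm (f x * b x ^ N) \<le> d"
    proof (cases "x \<in> Y")
      case True
      have "norm (f x * b x ^ N) = norm (f x) * norm (b x) ^ N" by (simp add: norm_mult norm_power)
      also have "\<dots> \<le> M * \<beta> ^ N" using M \<beta>(3)[OF True] x by (intro mult_mono power_mono) auto
      finally show ?thesis using N by simp
    next
      case False
      have "norm (b x) \<le> 1" using nb[OF x] S0[of x] L(1) by simp
      then have "norm (b x) ^ N \<le> 1" by (intro power_le_one) auto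
      then have "norm (f x) * norm (b x) ^ N \<le> d * 1" using False x d c0 by (intro mult_mono) (auto simp: Y_def)
      then show ?thesis by (simp add: norm_mult norm_power)
    qed
  qed
  then show False using d(2) by (simp add: bz)
qed

section \<open>Embeddings with disc-free hulls\<close>

lemma (in tower) unif_poly_P:
  assumes "compact S"
  shows "unif_poly S (\<lambda>z. P k (z $ i1) (z $ i2) (z $ i3))"
proof (induction k)
  case 0
  show ?case unfolding P.simps by (intro unif_poly_add poly_fun_imp_unif_poly poly_fun_const poly_fun_nth)
next
  case (Suc k)
  have "unif_poly S (\<lambda>z. lin k (z $ i1) (z $ i2))"
  proof (cases "first k")
    case True
    have "unif_poly S (\<lambda>z. 1 + z $ i1 * (- inverse (a k)))"
      by (intro unif_poly_add unif_poly_mult assms poly_fun_imp_unif_poly poly_fun_const poly_fun_nth)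
    then show ?thesis using True by (simp add: lin_def divide_inverse)
  next
    case False
    have "unif_poly S (\<lambda>z. 1 + z $ i2 * (- inverse (a k)))"
      by (intro unif_poly_add unif_poly_mult assms poly_fun_imp_unif_poly poly_fun_const poly_fun_nth)
    then show ?thesis using False by (simp add: lin_def divide_inverse)
  qed
  moreover have "unif_poly S (\<lambda>z. exp (of_real (m k) * (P k (z $ i1) (z $ i2) (z $ i3) + - 1)))"
    by (intro unif_poly_exp unif_poly_mult unif_poly_add Suc assms poly_fun_imp_unif_poly poly_fun_const)
  ultimately show ?case using unif_poly_mult[OF _ _ assms] by simp
qed

text \<open>A nonconstant \<open>h\<close> would have an open image, but every open disc about a
  real number contains non-real points.\<close>

lemma real_valued_holomorphic_constant:
  assumes "h holomorphic_on S" "open S" "connected S" "\<And>w. w \<in> S \<Longrightarrow> h w \<in> \<real>"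
  shows "h constant_on S"
proof (rule ccontr)
  assume nc: "\<not> ?thesis"
  then obtain w where w: "w \<in> S" by (auto simp: constant_on_def)
  have "open (h ` S)" using open_mapping_thm[OF assms(1-3) assms(2) order.refl nc] .
  then obtain e where e: "e > 0" "ball (h w) e \<subseteq> h ` S" using w open_contains_ball by blast
  have "h w + \<i> * of_real (e/2) \<in> ball (h w) e" using e(1) by (simp add: dist_norm norm_mult)
  then have "h w + \<i> * of_real (e/2) \<in> \<real>" using e(2) assms(4) by auto
  moreover have "h w \<in> \<real>" using assms(4) w by blast
  ultimately show False using e(1) by (simp add: complex_is_Real_iff)
qed

text \<open>Restriction to the coordinate 3-space of \<open>i1\<close>, \<open>i2\<close>,
  \<open>i3\<close>; it makes the value-attaining property of \<open>E\<close> available for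
  polynomials in all coordinates.\<close>

lemma entire3_poly_fun:
  fixes p :: "complex ^ 'a \<Rightarrow> complex"
  assumes p: "poly_fun p"
  shows "entire3 (\<lambda>z. p (\<chi> j. if j = i1 then fst z else if j = i2 then fst (snd z)
                       else if j = i3 then snd (snd z) else 0))"
proof -
  obtain A c where A: "finite A" "p = (\<lambda>z. \<Sum>\<alpha>\<in>A. c \<alpha> * (\<Prod>i\<in>UNIV. (z $ i) ^ (\<alpha> i)))"
    using p unfolding poly_fun_def by blast
  define \<iota> :: "complex \<times> complex \<times> complex \<Rightarrow> 'a \<Rightarrow> complex" where
    "\<iota> = (\<lambda>z j. if j = i1 then fst z else if j = i2 then fst (snd z) else if j = i3 then snd (snd z) else 0)"
  have cont: "continuous_on UNIV (\<lambda>z. \<iota> z j)" for j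
    unfolding \<iota>_def by (cases "j = i1"; cases "j = i2"; cases "j = i3"; simp add: continuous_on_fst continuous_on_snd continuous_on_id)
  have hol: "(\<lambda>w. \<iota> (f w, g w, h w) j) holomorphic_on S"
    if "f holomorphic_on S" "g holomorphic_on S" "h holomorphic_on S" for f g h S j
    using that unfolding \<iota>_def by (cases "j = i1"; cases "j = i2"; cases "j = i3"; simp)
  have "continuous_on UNIV (\<lambda>z. \<Sum>\<alpha>\<in>A. c \<alpha> * (\<Prod>i\<in>UNIV. \<iota> z i ^ \<alpha> i))"
    by (intro continuous_on_sum continuous_on_mult continuous_on_const continuous_on_prod continuous_on_power cont)
  moreover have "(\<lambda>w. \<Sum>\<alpha>\<in>A. c \<alpha> * (\<Prod>i\<in>UNIV. \<iota> (f w, g w, h w) i ^ \<alpha> i)) holomorphic_on S"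
    if "f holomorphic_on S" "g holomorphic_on S" "h holomorphic_on S" for f g h S
    by (intro holomorphic_on_sum holomorphic_on_mult holomorphic_on_const holomorphic_on_prod holomorphic_on_power
        hol that)
  ultimately have "entire3 (\<lambda>z. \<Sum>\<alpha>\<in>A. c \<alpha> * (\<Prod>i\<in>UNIV. \<iota> z i ^ \<alpha> i))"
    by (simp add: entire3_def)
  then show ?thesis by (simp add: A(2) \<iota>_def)
qed

text \<open>Of the four extra coordinates, \<open>i0\<close> will carry the distance to the copy of
  \<open>E\<close> and \<open>i1\<close>, \<open>i2\<close>, \<open>i3\<close> the map into
  \<open>\<complex>\<^sup>3\<close>; the coordinates of the original space are sent along
  \<open>e\<close>.\<close>

lemma split_coordinates:
  assumes "CARD('m::finite) = CARD('n::finite) + 4"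
  obtains i0 i1 i2 i3 :: "'m::finite" and e :: "'n::finite \<Rightarrow> 'm"
  where "distinct [i0, i1, i2, i3]" "bij_betw e UNIV (- {i0, i1, i2, i3})"
proof -
  have "4 \<le> card (UNIV :: 'm set)" using assms by simp
  then obtain T :: "'m set" where T: "card T = 4" "finite T" by (rule obtain_subset_with_card_n)
  obtain xs where xs: "set xs = T" "distinct xs" using finite_distinct_list[OF T(2)] by blast
  then have "length xs = 4" using T by (metis distinct_card)
  then obtain i0 i1 i2 i3 where ix: "xs = [i0, i1, i2, i3]"
    by (auto simp: length_Suc_conv eval_nat_numeral)
  have "card (- T) = CARD('n)" using T assms by (simp add: Compl_eq_Diff_UNIV card_Diff_subset)
  then obtain e :: "'n \<Rightarrow> 'm" where "bij_betw e UNIV (- T)"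
    using finite_same_card_bij[of "UNIV :: 'n set" "- T"] by auto
  then show ?thesis using that[of i0 i1 i2 i3 e] xs ix by auto
qed

theorem theorem1p1:
  fixes K :: "(real ^ 'n) set"
  assumes "compact K" and "uncountable K"
    and "CARD('m) = CARD('n) + 4"
  shows "\<exists>X :: (complex ^ 'm) set. X homeomorphic K \<and>
           poly_hull X - X \<noteq> {} \<and> contains_no_analytic_disc (poly_hull X)"
proof -
  obtain i0 i1 i2 i3 :: 'm and e :: "'n \<Rightarrow> 'm"
    where dist: "distinct [i0, i1, i2, i3]" and e: "bij_betw e UNIV (- {i0, i1, i2, i3})"
    using assms(3) by (rule split_coordinates)
  obtain a and first :: "nat \<Rightarrow> bool" where "tower a"
    and dense: "\<And>U b. open U \<Longrightarrow> U \<noteq> {} \<Longrightarrow> \<exists>k. first k = b \<and> a k \<in> U"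
    by (rule exists_dense_tower) (rule that)
  interpret tower a first by fact
  obtain E :: "(complex \<times> complex \<times> complex) set" and B :: "nat \<Rightarrow> (complex \<times> complex \<times> complex) set"
    where E: "compact E" "0 \<notin> E"
    and B: "\<And>i. open (B i)" "\<And>i. closed (E \<inter> B i)"
      "\<And>x y. x \<in> E \<Longrightarrow> y \<in> E \<Longrightarrow> x \<noteq> y \<Longrightarrow> \<exists>i. x \<in> B i \<and> y \<notin> B i"
    and EP: "\<And>z k. z \<in> E \<Longrightarrow> 1/2 \<le> Re (P k (fst z) (fst (snd z)) (snd (snd z)))"
    and Eq: "\<And>q. entire3 q \<Longrightarrow> \<exists>z\<in>E. q z = q 0"
    by (rule totally_disconnected_tower_set) (rule that)
  obtain g where g: "continuous_on E g" "inj_on g E" "g ` E \<subseteq> K"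
  proof (rule uncountable_compact_embeds_clopen_separated[OF assms(1,2) B(1,2)])
    show "\<exists>i. x \<in> B i \<and> y \<notin> B i" if "x \<in> E" "y \<in> E" "x \<noteq> y" for x y
      by (rule B(3)[OF that])
  qed (rule that)
  define C where "C = g ` E"
  have "entire3 (\<lambda>_. 0)" by (auto simp: entire3_def)
  then have "E \<noteq> {}" using Eq by blast
  then have C: "compact C" "closed C" "C \<noteq> {}" "C \<subseteq> K"
    using compact_continuous_image[OF g(1) E(1)] g(3) by (auto simp: C_def compact_imp_closed)
  have "continuous_on C (inv_into E g)"
    unfolding C_def using g(2) by (intro continuous_on_inv g(1) E(1)) auto
  moreover have "closedin (top_of_set K) C" using C by (simp add: closed_subset)
  \<comment> \<open>Off \<open>C\<close> the extension may take any values in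
    \<open>\<complex>\<^sup>3\<close>; membership in \<open>E\<close> is used only on
    \<open>C\<close>.\<close>
  ultimately obtain H where H: "continuous_on K H" "\<And>x. x \<in> C \<Longrightarrow> H x = inv_into E g x"
    by (rule Tietze_unbounded) blast
  have Hg: "H (g z) = z" if "z \<in> E" for z
    using that H(2)[of "g z"] g(2) by (simp add: C_def)
  have HC: "H x \<in> E" "g (H x) = x" if "x \<in> C" for x using that Hg by (auto simp: C_def)
  define d where "d = (\<lambda>x. infdist x C)"
  have d0: "d x = 0 \<longleftrightarrow> x \<in> C" for x
    unfolding d_def using in_closed_iff_infdist_zero[OF C(2,3)] by blast
  \<comment> \<open>Coordinate \<open>i0\<close> carries \<open>d x\<close> and the range of
    \<open>e\<close> carries \<open>d x * x\<close>: off \<open>C\<close> these determine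
    \<open>x\<close>, and on \<open>C\<close> they all vanish. The values of \<open>F\<close> at
    \<open>i1\<close>, \<open>i2\<close>, \<open>i3\<close> are discarded by
    \<open>\<Phi>\<close>.\<close>
  define F where "F = (\<lambda>x j. d x * (if j = i0 then 1 else x $ inv e j))"
  define J where "J = - {i1, i2, i3}"
  have i0J: "i0 \<in> J" using dist by (auto simp: J_def)
  have eJ: "e i \<in> J" "e i \<noteq> i0" for i using e by (auto simp: J_def bij_betw_def)
  have inv_e: "inv e (e i) = i" for i using e by (simp add: bij_betw_def)
  have F_inj: "x = y" if F: "\<And>j. j \<in> J \<Longrightarrow> F x j = F y j" and x: "x \<notin> C" for x y
  proof -
    have dd: "d x = d y" using F[OF i0J] by (simp add: F_def)
    have "x $ i = y $ i" for i
      using F[OF eJ(1)[of i]] eJ(2)[of i] dd x d0[of x] by (simp add: F_def inv_e)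
    then show ?thesis by (simp add: vec_eq_iff)
  qed
  define \<Phi> :: "real ^ 'n \<Rightarrow> complex ^ 'm" where "\<Phi> = (\<lambda>x. \<chi> j. if j = i1 then fst (H x)
      else if j = i2 then fst (snd (H x)) else if j = i3 then snd (snd (H x)) else of_real (F x j))"
  have \<Phi>I: "\<Phi> x $ i1 = fst (H x)" "\<Phi> x $ i2 = fst (snd (H x))" "\<Phi> x $ i3 = snd (snd (H x))" for x
    using dist by (auto simp: \<Phi>_def)
  have \<Phi>J: "\<Phi> x $ j = of_real (F x j)" if "j \<in> J" for x j using that by (auto simp: \<Phi>_def J_def)
  have \<Phi>cont: "continuous_on K \<Phi>"
    unfolding \<Phi>_def
  proof (rule continuous_on_vec_lambda)
    fix j
    have "continuous_on K (\<lambda>x. F x j)"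
      unfolding F_def d_def by (cases "j = i0") (auto intro!: continuous_intros)
    then show "continuous_on K (\<lambda>x. if j = i1 then fst (H x) else if j = i2 then fst (snd (H x))
        else if j = i3 then snd (snd (H x)) else complex_of_real (F x j))"
      using H(1) by (cases "j = i1"; cases "j = i2"; cases "j = i3") (auto intro!: continuous_intros)
  qed
  have \<Phi>inj: "inj_on \<Phi> K"
  proof (rule inj_onI)
    fix x y assume xy: "\<Phi> x = \<Phi> y"
    have F: "F x j = F y j" if "j \<in> J" for j
      using xy \<Phi>J[OF that, of x] \<Phi>J[OF that, of y] by simp
    show "x = y"
    proof (cases "x \<in> C")
      case False
      then show ?thesis using F_inj[of x y] F by blast
    next
      case True
      have "d x = d y" using F[OF i0J] by (simp add: F_def)
      then have "y \<in> C" using True d0 by metis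
      moreover have "H x = H y" using xy \<Phi>I[of x] \<Phi>I[of y] by (simp add: prod_eq_iff)
      ultimately show ?thesis using HC(2) True by metis
    qed
  qed
  define X where "X = \<Phi> ` K"
  have X: "compact X" "X \<noteq> {}"
    using compact_continuous_image[OF \<Phi>cont assms(1)] C by (auto simp: X_def)
  have "homeomorphism K X \<Phi> (inv_into K \<Phi>)"
    unfolding X_def
  proof (rule homeomorphismI)
    show "continuous_on (\<Phi> ` K) (inv_into K \<Phi>)"
      using \<Phi>inj by (intro continuous_on_inv \<Phi>cont assms(1)) auto
  qed (use \<Phi>cont \<Phi>inj in \<open>auto simp: inv_into_into f_inv_into_f\<close>)
  then have homeo: "X homeomorphic K" unfolding homeomorphic_def using homeomorphism_symD by blast
  \<comment> \<open>For \<open>z \<in> E\<close> the point \<open>\<Phi> (g z)\<close> is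
    \<open>z\<close> placed in the coordinates \<open>i1\<close>, \<open>i2\<close>,
    \<open>i3\<close>. So each polynomial takes its value at \<open>0\<close> somewhere on
    \<open>X\<close>.\<close>
  have "0 \<in> poly_hull X"
    unfolding poly_hull_def
  proof (intro CollectI allI impI)
    fix p :: "complex ^ 'm \<Rightarrow> complex" assume p: "poly_fun p"
    let ?\<iota> = "\<lambda>z :: complex \<times> complex \<times> complex. (\<chi> j. if j = i1 then fst z else if j = i2 then fst (snd z)
                       else if j = i3 then snd (snd z) else 0) :: complex ^ 'm"
    obtain z where z: "z \<in> E" "p (?\<iota> z) = p (?\<iota> 0)" using Eq[OF entire3_poly_fun[OF p]] by blast
    have "?\<iota> 0 = 0" by (simp add: vec_eq_iff)
    moreover have "?\<iota> z = \<Phi> (g z)"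
    proof -
      have "d (g z) = 0" using d0[of "g z"] z(1) by (simp add: C_def)
      then show ?thesis using z(1) by (simp add: \<Phi>_def Hg F_def vec_eq_iff)
    qed
    ultimately have eq: "p 0 = p (\<Phi> (g z))" using z(2) by simp
    have "bdd_above ((\<lambda>x. norm (p x)) ` X)"
      using X(1) by (intro bounded_imp_bdd_above compact_imp_bounded compact_continuous_image
          continuous_on_norm continuous_on_poly_fun[OF p])
    moreover have "\<Phi> (g z) \<in> X" using z(1) g(3) by (auto simp: X_def)
    ultimately show "norm (p 0) \<le> (SUP x\<in>X. norm (p x))"
      unfolding eq by (rule cSUP_upper[rotated])
  qed
  moreover have "0 \<notin> X"
  proof
    assume "0 \<in> X"
    then obtain x where x: "\<Phi> x = 0" by (auto simp: X_def)
    have "F x i0 = 0" using \<Phi>J[OF i0J, of x] x by simp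
    then have "x \<in> C" using d0 by (simp add: F_def)
    moreover have "H x = 0" using \<Phi>I[of x] x by (simp add: prod_eq_iff)
    ultimately show False using HC(1) E(2) by metis
  qed
  ultimately have nontriv: "poly_hull X - X \<noteq> {}" by blast
  have realX: "x $ j \<in> \<real>" if "x \<in> X" "j \<in> J" for x j
    using that \<Phi>J by (auto simp: X_def)
  \<comment> \<open>The coordinates in \<open>J\<close> are real on \<open>X\<close>, so
    \<open>poly_hull_fibre\<close> reduces the hull to fibres over them: single points off
    \<open>C\<close>, and a copy of \<open>E\<close> over the origin.\<close>
  have hull: "(\<exists>x\<in>K - C. z = \<Phi> x) \<or>
      ((\<forall>j\<in>J. z $ j = 0) \<and> (\<forall>k. 1/2 \<le> Re (P k (z $ i1) (z $ i2) (z $ i3))))" if z: "z \<in> poly_hull X" for z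
  proof -
    note fibre = poly_hull_fibre[OF z X realX]
    have comp: "compact (insert z X)" using X(1) by simp
    obtain x where x: "x \<in> K" "\<And>j. j \<in> J \<Longrightarrow> \<Phi> x $ j = z $ j"
    proof (rule ccontr)
      assume neg: "\<not> thesis"
      \<comment> \<open>Over an empty fibre, \<open>poly_hull_fibre\<close> would bound the constant
        1 by 0.\<close>
      have "norm (1::complex) \<le> 0"
      proof (rule fibre[of J "\<lambda>_. 1"])
        show "unif_poly (insert z X) (\<lambda>_. 1)" by (intro poly_fun_imp_unif_poly poly_fun_const)
        show "norm (1::complex) \<le> 0" if "y \<in> X" "\<And>j. j \<in> J \<Longrightarrow> y $ j = z $ j" for y
          using neg \<open>\<And>x. x \<in> K \<Longrightarrow> (\<And>j. j \<in> J \<Longrightarrow> \<Phi> x $ j = z $ j) \<Longrightarrow> thesis\<close> that by (auto simp: X_def)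
      qed auto
      then show False by simp
    qed
    have Fx: "F y j = F x j" if "\<Phi> y $ j = z $ j" "j \<in> J" for y j
      using that x(2)[OF that(2)] \<Phi>J[OF that(2), of x] \<Phi>J[OF that(2), of y] by (metis of_real_eq_iff)
    show ?thesis
    proof (cases "x \<in> C")
      case False
      have "z $ i = \<Phi> x $ i" for i
      proof -
        \<comment> \<open>The fibre is the single point \<open>\<Phi> x\<close>, where this
          coordinate difference vanishes; the fibre lemma with bound 0 carries that over to
          \<open>z\<close>.\<close>
        have "norm (z $ i + - \<Phi> x $ i) \<le> 0"
        proof (rule fibre[of J "\<lambda>w. w $ i + - \<Phi> x $ i"])
          show "unif_poly (insert z X) (\<lambda>w. w $ i + - \<Phi> x $ i)"
            by (intro unif_poly_add poly_fun_imp_unif_poly poly_fun_const poly_fun_nth)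
          show "continuous_on X (\<lambda>w. w $ i + - \<Phi> x $ i)" by (intro continuous_intros)
          show "norm (w $ i + - \<Phi> x $ i) \<le> 0" if w: "w \<in> X" "\<And>j. j \<in> J \<Longrightarrow> w $ j = z $ j" for w
          proof -
            obtain y where y: "w = \<Phi> y" using w(1) by (auto simp: X_def)
            have "x = y" using F_inj[of x y] Fx[of y] w(2) y False by simp
            then show ?thesis using y by simp
          qed
        qed auto
        then show ?thesis by simp
      qed
      then have "z = \<Phi> x" by (simp add: vec_eq_iff)
      then show ?thesis using x(1) False by blast
    next
      case True
      have z0: "z $ j = 0" if "j \<in> J" for j
        using x(2)[OF that] \<Phi>J[OF that, of x] True d0[of x] by (simp add: F_def)
      have "1/2 \<le> Re (P k (z $ i1) (z $ i2) (z $ i3))" for k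
      proof -
        \<comment> \<open>The modulus of \<open>exp (- P k)\<close> is
          \<open>exp (- Re (P k))\<close>, so a lower bound for the real part on the fibre becomes
          an upper bound for a modulus.\<close>
        let ?f = "\<lambda>w :: complex ^ 'm. exp (P k (w $ i1) (w $ i2) (w $ i3) * - 1)"
        have "norm (?f z) \<le> exp (- (1/2))"
        proof (rule fibre[of J ?f])
          show "unif_poly (insert z X) ?f"
            by (intro unif_poly_exp unif_poly_mult unif_poly_P comp poly_fun_imp_unif_poly poly_fun_const)
          have "continuous_on X (\<lambda>w. (\<lambda>z. P k (fst z) (fst (snd z)) (snd (snd z))) (w $ i1, w $ i2, w $ i3))"
            by (rule continuous_on_compose2[OF continuous_on_P]) (auto intro!: continuous_intros)
          then show "continuous_on X ?f" by (auto intro!: continuous_intros)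
          show "norm (?f w) \<le> exp (- (1/2))" if w: "w \<in> X" "\<And>j. j \<in> J \<Longrightarrow> w $ j = z $ j" for w
          proof -
            obtain y where y: "w = \<Phi> y" using w(1) by (auto simp: X_def)
            have "F y i0 = F x i0" using Fx[OF _ i0J, of y] w(2)[OF i0J] y by simp
            then have "y \<in> C" using True d0[of x] d0[of y] by (simp add: F_def)
            then show ?thesis using EP[OF HC(1)] y \<Phi>I[of y] by simp
          qed
        qed auto
        then show ?thesis by simp
      qed
      then show ?thesis using z0 by blast
    qed
  qed
  have "contains_no_analytic_disc (poly_hull X)"
    unfolding contains_no_analytic_disc_def
  proof
    assume "\<exists>\<sigma>. analytic_disc \<sigma> \<and> \<sigma> ` ball 0 1 \<subseteq> poly_hull X"
    then obtain \<sigma> where \<sigma>: "analytic_disc \<sigma>" "\<sigma> ` ball 0 1 \<subseteq> poly_hull X" by blast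
    then have inj: "inj_on \<sigma> (ball 0 1)"
      and hol: "\<And>i. (\<lambda>w. \<sigma> w $ i) holomorphic_on ball 0 1"
      and im: "\<And>w. w \<in> ball 0 1 \<Longrightarrow> \<sigma> w \<in> poly_hull X"
      by (auto simp: analytic_disc_def)
    have b: "(0::complex) \<in> ball 0 1" "(1/2::complex) \<in> ball 0 1" by auto
    have const: "\<sigma> w $ j = \<sigma> w' $ j" if j: "j \<in> J" and w: "w \<in> ball 0 1" "w' \<in> ball 0 1" for w w' j
    proof -
      have "(\<lambda>w. \<sigma> w $ j) constant_on ball 0 1"
        by (rule real_valued_holomorphic_constant[OF hol open_ball connected_ball])
           (rule poly_hull_real_coordinate[OF im X realX[OF _ j]])
      then show ?thesis using w unfolding constant_on_def by metis
    qed
    have "\<sigma> 0 = \<sigma> (1/2)"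
    \<comment> \<open>Coordinate \<open>i0\<close> is constant on the disc. If it is nonzero, all
      points of the disc have the form \<open>\<Phi> x\<close> with the same real coordinates, and
      \<open>F_inj\<close> identifies them; if it is zero, the disc lies over the origin and
      \<open>holomorphic_discs_constant\<close> applies.\<close>
    proof (cases "\<sigma> 0 $ i0 = 0")
      case False
      have ex: "\<exists>x\<in>K - C. \<sigma> w = \<Phi> x" if "w \<in> ball 0 1" for w
        using hull[OF im[OF that]] False const[OF i0J b(1) that] i0J by auto
      obtain x y where xy: "x \<in> K - C" "\<sigma> 0 = \<Phi> x" "y \<in> K - C" "\<sigma> (1/2) = \<Phi> y"
        using ex[OF b(1)] ex[OF b(2)] by blast
      have "F x j = F y j" if "j \<in> J" for j
        using const[OF that b] xy \<Phi>J[OF that, of x] \<Phi>J[OF that, of y] by simp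
      then have "x = y" using F_inj[of x y] xy by blast
      then show ?thesis using xy by simp
    next
      case True
      have in0: "(\<forall>j\<in>J. \<sigma> w $ j = 0) \<and> (\<forall>k. 1/2 \<le> Re (P k (\<sigma> w $ i1) (\<sigma> w $ i2) (\<sigma> w $ i3)))"
        if w: "w \<in> ball 0 1" for w
      proof -
        have "\<not> (\<exists>x\<in>K - C. \<sigma> w = \<Phi> x)"
        proof
          assume "\<exists>x\<in>K - C. \<sigma> w = \<Phi> x"
          then obtain x where x: "x \<notin> C" "\<sigma> w = \<Phi> x" by blast
          have "F x i0 = 0" using const[OF i0J b(1) w] True x(2) \<Phi>J[OF i0J, of x] by simp
          then show False using x(1) d0[of x] by (simp add: F_def)
        qed
        then show ?thesis using hull[OF im[OF w]] by blast
      qed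
      have "(\<lambda>w. \<sigma> w $ i1) constant_on ball 0 1" "(\<lambda>w. \<sigma> w $ i2) constant_on ball 0 1"
          "(\<lambda>w. \<sigma> w $ i3) constant_on ball 0 1"
        using holomorphic_discs_constant[OF hol[of i1] hol[of i2] hol[of i3] _ dense] in0 by blast+
      then have "\<sigma> 0 $ i = \<sigma> (1/2) $ i" if "i \<in> {i1, i2, i3}" for i
        using that b unfolding constant_on_def by (metis empty_iff insert_iff)
      moreover have "\<sigma> 0 $ i = \<sigma> (1/2) $ i" if "i \<in> J" for i
        using const[OF that b] .
      ultimately show ?thesis unfolding vec_eq_iff J_def by blast
    qed
    then show False using inj_onD[OF inj _ b] by simp
  qed
  then show ?thesis using homeo nontriv by blast
qed

end
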